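(* Let $T>0$, let $\varepsilon$ be a nonzero real number with $|\varepsilon|<1$, and let $\Omega=\{(x,t): -\pi<x<\pi,\ 0<t<T\}$. Let $\varphi,\psi\in C^2[-\pi,\pi]$ with $\varphi''',\psi'''\in L_2(-\pi,\pi)$ and $\varphi^{(i)}(-\pi)=-\varphi^{(i)}(\pi)$, $\psi^{(i)}(-\pi)=-\psi^{(i)}(\pi)$ for $i=0,1,2$. Consider the inverse problem of finding a pair $(u,f)$ with $u\in C^{2,1}_{x,t}(\Omega)$, $f\in C[-\pi,\pi]$, such that $$u_t(x,t)-u_{xx}(x,t)+\varepsilon u_{xx}(-x,t)=f(x),\quad (x,t)\in\Omega,$$ $$u(x,0)=\varphi(x),\quad u(x,T)=\psi(x),\quad x\in[-\pi,\pi],$$ $$u(-\pi,t)=-u(\pi,t),\quad u_x(-\pi,t)=-u_x(\pi,t),\quad t\in[0,T].$$ Then a unique solution of this problem exists, and it is given by $$u(x,t)=\varphi(x)-\sum_{k=0}^\infty\frac{\left(1-e^{-(1-\varepsilon)(k+\frac12)^2t}\right)\left(\varphi^{(3)}_{2k}-\psi^{(3)}_{2k}\right)}{\left(1-e^{-(1-\varepsilon)(k+\frac12)^2T}\right)(k+\frac12)^3}\cos\left(k+\tfrac12\right)x+\sum_{k=0}^\infty\frac{\left(1-e^{-(1+\varepsilon)(k+\frac12)^2t}\right)\left(\varphi^{(3)}_{1k}-\psi^{(3)}_{1k}\right)}{\left(1-e^{-(1+\varepsilon)(k+\frac12)^2T}\right)(k+\frac12)^3}\sin\left(k+\tfrac12\right)x,$$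 $$f(x)=-\varphi''(x)+\varepsilon\varphi''(-x)-\sum_{k=0}^\infty\frac{(1-\varepsilon)\left(\varphi^{(3)}_{2k}-\psi^{(3)}_{2k}\right)}{(k+\frac12)\left(1-e^{-(1-\varepsilon)(k+\frac12)^2T}\right)}\cos\left(k+\tfrac12\right)x+\sum_{k=0}^\infty\frac{(1+\varepsilon)\left(\varphi^{(3)}_{1k}-\psi^{(3)}_{1k}\right)}{(k+\frac12)\left(1-e^{-(1+\varepsilon)(k+\frac12)^2T}\right)}\sin\left(k+\tfrac12\right)x,$$ where $$\varphi^{(3)}_{1k}=\frac1\pi\int_{-\pi}^\pi\varphi'''(x)\cos\left(k+\tfrac12\right)x\,dx,\quad \varphi^{(3)}_{2k}=\frac1\pi\int_{-\pi}^\pi\varphi'''(x)\sin\left(k+\tfrac12\right)x\,dx,$$ $$\psi^{(3)}_{1k}=\frac1\pi\int_{-\pi}^\pi\psi'''(x)\cos\left(k+\tfrac12\right)x\,dx,\quad \psi^{(3)}_{2k}=\frac1\pi\int_{-\pi}^\pi\psi'''(x)\sin\left(k+\tfrac12\right)x\,dx.$$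
   Context: $C^{2,1}_{x,t}(\Omega)$ denotes functions on $\Omega$ that are twice continuously differentiable in $x$ and once continuously differentiable in $t$. A pair $(u,f)$ with $u\in C^{2,1}_{x,t}(\Omega)$, $f\in C[-\pi,\pi]$ satisfying the equation and conditions is called a regular solution. *)

theory Defs
  imports "HOL-Analysis.Analysis"
begin

text \<open>Data regularity: g \<in> C^2[-pi,pi], with g''' \<in> L_2(-pi,pi) understood as:
  g'' is absolutely continuous with a.e. derivative g3 which is square integrable,
  i.e. g2 x = g2(-pi) + integral of g3 from -pi to x. Also anti-periodic
  boundary conditions for g, g', g''.\<close>
definition admissible_data ::
  "(real \<Rightarrow> real) \<Rightarrow> (real \<Rightarrow> real) \<Rightarrow> (real \<Rightarrow> real) \<Rightarrow> (real \<Rightarrow> real) \<Rightarrow> bool" where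
  "admissible_data g g1 g2 g3 \<longleftrightarrow>
     (\<forall>x\<in>{-pi..pi}. (g has_real_derivative g1 x) (at x within {-pi..pi})) \<and>
     (\<forall>x\<in>{-pi..pi}. (g1 has_real_derivative g2 x) (at x within {-pi..pi})) \<and>
     continuous_on {-pi..pi} g2 \<and>
     set_borel_measurable lborel {-pi..pi} g3 \<and>
     set_integrable lborel {-pi..pi} (\<lambda>x. (g3 x)\<^sup>2) \<and>
     (\<forall>x\<in>{-pi..pi}. g2 x = g2 (-pi) + (LBINT y:{-pi..x}. g3 y)) \<and>
     g (-pi) = - g pi \<and> g1 (-pi) = - g1 pi \<and> g2 (-pi) = - g2 pi"

definition coef1 :: "(real \<Rightarrow> real) \<Rightarrow> nat \<Rightarrow> real" where
  "coef1 g3 k = (1 / pi) * (LBINT x:{-pi..pi}. g3 x * cos ((real k + 1/2) * x))"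

definition coef2 :: "(real \<Rightarrow> real) \<Rightarrow> nat \<Rightarrow> real" where
  "coef2 g3 k = (1 / pi) * (LBINT x:{-pi..pi}. g3 x * sin ((real k + 1/2) * x))"

text \<open>Regular solution: u continuous on the closed rectangle, u_x exists (one-sided at
  x = +-pi) and is continuous on the closed rectangle (needed to state the boundary
  conditions), u_xx and u_t exist and are continuous in the open rectangle Omega,
  f continuous on [-pi,pi], and the equation and conditions hold.\<close>
definition regular_solution ::
  "real \<Rightarrow> real \<Rightarrow> (real \<Rightarrow> real) \<Rightarrow> (real \<Rightarrow> real) \<Rightarrow> (real \<times> real \<Rightarrow> real) \<Rightarrow> (real \<Rightarrow> real) \<Rightarrow> bool" where
  "regular_solution T \<epsilon> \<phi> \<psi> u f \<longleftrightarrow>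
     (\<exists>ux uxx ut.
        continuous_on ({-pi..pi} \<times> {0..T}) u \<and>
        (\<forall>x\<in>{-pi..pi}. \<forall>t\<in>{0..T}.
            ((\<lambda>y. u (y, t)) has_real_derivative ux (x, t)) (at x within {-pi..pi})) \<and>
        continuous_on ({-pi..pi} \<times> {0..T}) ux \<and>
        (\<forall>x\<in>{-pi<..<pi}. \<forall>t\<in>{0<..<T}.
            ((\<lambda>y. ux (y, t)) has_real_derivative uxx (x, t)) (at x) \<and>
            ((\<lambda>s. u (x, s)) has_real_derivative ut (x, t)) (at t)) \<and>
        continuous_on ({-pi<..<pi} \<times> {0<..<T}) uxx \<and>
        continuous_on ({-pi<..<pi} \<times> {0<..<T}) ut \<and>
        continuous_on {-pi..pi} f \<and>
        (\<forall>x\<in>{-pi<..<pi}. \<forall>t\<in>{0<..<T}.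
            ut (x, t) - uxx (x, t) + \<epsilon> * uxx (-x, t) = f x) \<and>
        (\<forall>x\<in>{-pi..pi}. u (x, 0) = \<phi> x \<and> u (x, T) = \<psi> x) \<and>
        (\<forall>t\<in>{0..T}. u (-pi, t) = - u (pi, t) \<and> ux (-pi, t) = - ux (pi, t)))"

definition sol_u ::
  "real \<Rightarrow> real \<Rightarrow> (real \<Rightarrow> real) \<Rightarrow> (real \<Rightarrow> real) \<Rightarrow> (real \<Rightarrow> real) \<Rightarrow> real \<times> real \<Rightarrow> real" where
  "sol_u T \<epsilon> \<phi> \<phi>3 \<psi>3 = (\<lambda>(x, t).
     \<phi> x
     - (\<Sum>k. (1 - exp (-(1 - \<epsilon>) * (real k + 1/2)\<^sup>2 * t)) * (coef2 \<phi>3 k - coef2 \<psi>3 k)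
              / ((1 - exp (-(1 - \<epsilon>) * (real k + 1/2)\<^sup>2 * T)) * (real k + 1/2) ^ 3)
              * cos ((real k + 1/2) * x))
     + (\<Sum>k. (1 - exp (-(1 + \<epsilon>) * (real k + 1/2)\<^sup>2 * t)) * (coef1 \<phi>3 k - coef1 \<psi>3 k)
              / ((1 - exp (-(1 + \<epsilon>) * (real k + 1/2)\<^sup>2 * T)) * (real k + 1/2) ^ 3)
              * sin ((real k + 1/2) * x)))"

definition sol_f ::
  "real \<Rightarrow> real \<Rightarrow> (real \<Rightarrow> real) \<Rightarrow> (real \<Rightarrow> real) \<Rightarrow> (real \<Rightarrow> real) \<Rightarrow> real \<Rightarrow> real" where
  "sol_f T \<epsilon> \<phi>2 \<phi>3 \<psi>3 = (\<lambda>x.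
     - \<phi>2 x + \<epsilon> * \<phi>2 (-x)
     - (\<Sum>k. (1 - \<epsilon>) * (coef2 \<phi>3 k - coef2 \<psi>3 k)
              / ((real k + 1/2) * (1 - exp (-(1 - \<epsilon>) * (real k + 1/2)\<^sup>2 * T)))
              * cos ((real k + 1/2) * x))
     + (\<Sum>k. (1 + \<epsilon>) * (coef1 \<phi>3 k - coef1 \<psi>3 k)
              / ((real k + 1/2) * (1 - exp (-(1 + \<epsilon>) * (real k + 1/2)\<^sup>2 * T)))
              * sin ((real k + 1/2) * x)))"

end

theory Submission
  imports Defs
begin

text \<open>The functions \<open>cos (k + 1/2) x\<close> and \<open>sin (k + 1/2) x\<close> are a complete orthogonal system on
  \<open>[-\<pi>, \<pi>]\<close>, and the reflection \<open>x \<mapsto> -x\<close> acts on them by \<open>\<plusminus>1\<close>; hence the equation decouples into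
  ordinary differential equations \<open>c' = F - (1 \<minusplus> \<epsilon>) (k + 1/2)\<^sup>2 c\<close> with constant unknown \<open>F\<close>, and the
  values of \<open>c\<close> at \<open>0\<close> and \<open>T\<close> determine \<open>F\<close> and \<open>c\<close>.  This gives uniqueness.  For existence,
  three integrations by parts turn the coefficients of \<open>\<phi> - \<psi>\<close> into those of
  \<open>\<phi>''' - \<psi>'''\<close> over \<open>(k + 1/2)\<^sup>3\<close>; the latter are square summable by Bessel's inequality, so the
  series for \<open>u\<^sub>x\<^sub>x\<close>, \<open>u\<^sub>t\<close> and \<open>f\<close>, whose terms are of order coefficient over \<open>k + 1/2\<close>,
  converge absolutely and uniformly.\<close>

subsection \<open>Half-integer frequencies\<close>

text \<open>Anti-periodicity in \<open>x\<close> is what forces half-integer frequencies, and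
  \<open>\<bar>\<epsilon>\<bar> < 1\<close> makes both decay rates positive. Completeness rests on
  Weierstrass approximation in \<open>cos x\<close>: multiplying by \<open>cos x\<close> moves a
  frequency to its two neighbours, and the lowest frequency 1/2 is reflected to itself, so
  orthogonality to the system passes to all products with powers of \<open>cos x\<close>.
  Completeness is used twice: for uniqueness, and to check the condition at \<open>t = T\<close>.
  There the series is never summed to \<phi> - \<psi> by a convergence theorem; both sides merely
  have the same coefficients. Hence only absolutely convergent series occur.\<close>

text \<open>The phase \<open>\<theta> = 0\<close> gives the cosines and \<open>\<theta> = \<pi>/2\<close> the sines; with a free phase, differentiation is
  the shift \<open>\<theta> \<mapsto> \<theta> - \<pi>/2\<close> together with a factor \<open>k + 1/2\<close>, so both families are treated at once.\<close>
definition hcos :: "real \<Rightarrow> nat \<Rightarrow> real \<Rightarrow> real" where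
  "hcos \<theta> k x = cos ((real k + 1/2) * x - \<theta>)"

lemma hcos_0: "hcos 0 k x = cos ((real k + 1/2) * x)"
  by (simp add: hcos_def)

lemma hcos_pi_half: "hcos (pi/2) k x = sin ((real k + 1/2) * x)"
  by (simp add: hcos_def cos_diff)

lemma hcos_add_pi: "hcos (\<theta> + pi) k x = - hcos \<theta> k x"
  by (simp add: hcos_def cos_diff cos_add sin_add)

lemma abs_hcos_le_1: "\<bar>hcos \<theta> k x\<bar> \<le> 1"
  by (simp add: hcos_def)

lemma has_real_derivative_hcos:
  "(hcos \<theta> k has_real_derivative (real k + 1/2) * hcos (\<theta> - pi/2) k x) (at x within S)"
proof -
  have "hcos (\<theta> - pi/2) k x = - sin ((real k + 1/2) * x - \<theta>)"
    by (simp add: hcos_def cos_diff sin_diff)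
  then show ?thesis
    unfolding hcos_def[of \<theta> k, abs_def] by (auto intro!: derivative_eq_intros)
qed

lemma continuous_on_hcos [continuous_intros]:
  fixes g :: "'a::t2_space \<Rightarrow> real"
  shows "continuous_on S g \<Longrightarrow> continuous_on S (\<lambda>x. hcos \<theta> k (g x))"
  unfolding hcos_def by (auto intro!: continuous_intros)

lemma cos_half_integer_pi: "cos ((real k + 1/2) * pi) = 0"
proof -
  have "(real k + 1/2) * pi = real k * pi + pi/2" by (simp add: algebra_simps)
  then show ?thesis by (simp only: cos_add) simp
qed

text \<open>The two arguments differ by an odd multiple of pi. This is why boundary terms cancel
  against anti-periodic data.\<close>

lemma hcos_antiperiodic: "hcos \<theta> k (- pi) = - hcos \<theta> k pi"
  by (simp add: hcos_def cos_diff cos_half_integer_pi del: minus_mult_right)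

text \<open>The recursion between neighbouring frequencies that drives the completeness proof. Raw
  cosines stay on the right because \<open>k - 1\<close> leaves the naturals at
  \<open>k = 0\<close>.\<close>

lemma cos_times_hcos:
  "cos x * hcos \<theta> k x = (cos ((real k + 3/2) * x - \<theta>) + cos ((real k - 1/2) * x - \<theta>)) / 2"
proof -
  have "(real k + 3/2) * x - \<theta> = ((real k + 1/2) * x - \<theta>) + x"
       "(real k - 1/2) * x - \<theta> = ((real k + 1/2) * x - \<theta>) - x"
    by (simp_all add: algebra_simps)
  then show ?thesis unfolding hcos_def by (simp only: cos_add cos_diff[of _ x]) simp
qed

subsection \<open>Orthogonality and completeness\<close>

lemma integral_cos_int_mult:
  "integral {-pi..pi} (\<lambda>x. cos (of_int m * x - \<theta>)) = (if m = 0 then 2 * pi * cos \<theta> else 0)"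
proof (cases "m = 0")
  case False
  have "((\<lambda>x. cos (of_int m * x - \<theta>)) has_integral
      (sin (of_int m * pi - \<theta>) / of_int m - sin (of_int m * (-pi) - \<theta>) / of_int m)) {-pi..pi}"
    by (rule fundamental_theorem_of_calculus)
      (use False in \<open>auto intro!: derivative_eq_intros
        simp flip: has_real_derivative_iff_has_vector_derivative\<close>)
  moreover have "sin (of_int m * pi) = 0" by (simp add: sin_zero_iff_int2)
  ultimately show ?thesis
    using False by (auto dest!: integral_unique simp: sin_diff)
qed simp

text \<open>The product-to-sum formula has the integer frequencies \<open>j - k\<close> and
  \<open>j + k + 1\<close>, and the second never vanishes. Independent phases include the
  orthogonality of cosines and sines as the case \<open>cos (pi/2) = 0\<close>.\<close>

lemma hcos_orthogonal:
  "integral {-pi..pi} (\<lambda>x. hcos \<theta> j x * hcos \<theta>' k x) = (if j = k then pi * cos (\<theta> - \<theta>') else 0)"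
proof -
  have "hcos \<theta> j x * hcos \<theta>' k x =
      (cos (of_int (int j - int k) * x - (\<theta> - \<theta>')) + cos (of_int (int j + int k + 1) * x - (\<theta> + \<theta>'))) / 2" for x
  proof -
    have "of_int (int j - int k) * x - (\<theta> - \<theta>') = ((real j + 1/2) * x - \<theta>) - ((real k + 1/2) * x - \<theta>')"
         "of_int (int j + int k + 1) * x - (\<theta> + \<theta>') = ((real j + 1/2) * x - \<theta>) + ((real k + 1/2) * x - \<theta>')"
      by (simp_all add: algebra_simps)
    then show ?thesis unfolding hcos_def by (simp only: cos_times_cos)
  qed
  moreover have "integral {-pi..pi} (\<lambda>x. (cos (of_int m * x - a) + cos (of_int n * x - b)) / 2) =
     (integral {-pi..pi} (\<lambda>x. cos (of_int m * x - a)) + integral {-pi..pi} (\<lambda>x. cos (of_int n * x - b))) / 2"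
     for m n a b
    by (subst integral_add[symmetric])
       (auto intro!: integrable_continuous_real continuous_intros)
  ultimately have "integral {-pi..pi} (\<lambda>x. hcos \<theta> j x * hcos \<theta>' k x) =
      (integral {-pi..pi} (\<lambda>x. cos (of_int (int j - int k) * x - (\<theta> - \<theta>'))) +
       integral {-pi..pi} (\<lambda>x. cos (of_int (int j + int k + 1) * x - (\<theta> + \<theta>')))) / 2"
    by presburger
  then show ?thesis
    unfolding integral_cos_int_mult by auto
qed

text \<open>An even continuous function on \<open>[-\<pi>, \<pi>]\<close> is a continuous function of \<open>cos x\<close>,
  so the Weierstrass theorem on \<open>[-1, 1]\<close> applies.\<close>
lemma even_part_zero_if_orthogonal_cos_powers:
  fixes K :: "real \<Rightarrow> real"
  assumes K: "continuous_on {-pi..pi} K"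
    and orth: "\<And>n. integral {-pi..pi} (\<lambda>x. K x * cos x ^ n) = 0"
    and x: "x \<in> {-pi..pi}"
  shows "K x + K (- x) = 0"
proof -
  define M where "M x = K x + K (- x)" for x
  have K': "continuous_on {-pi..pi} (\<lambda>x. K (- x))"
    by (rule continuous_on_compose2[OF K]) (auto intro!: continuous_intros)
  have M: "continuous_on {-pi..pi} M"
    unfolding M_def by (intro continuous_intros K K')
  have Mint: "f integrable_on {-pi..pi}" if "continuous_on {-pi..pi} f" for f :: "real \<Rightarrow> real"
    using that by (rule integrable_continuous_real)
  have Morth: "integral {-pi..pi} (\<lambda>x. M x * cos x ^ n) = 0" for n
  proof -
    \<comment> \<open>The weight \<open>cos x ^ n\<close> is even, so reflection carries the
      orthogonality of \<open>K\<close> over to \<open>M\<close>.\<close>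
    have "integral {-pi..pi} (\<lambda>x. K (- x) * cos x ^ n) = integral {-pi..pi} (\<lambda>x. K x * cos x ^ n)"
      using Henstock_Kurzweil_Integration.integral_reflect_real
        [of pi "-pi" "\<lambda>x. K x * cos x ^ n"] by simp
    then show ?thesis
      unfolding M_def distrib_right
      by (subst integral_add) (auto intro!: Mint continuous_intros K K' simp: orth)
  qed
  define q where "q y = M (arccos y)" for y
  have q: "continuous_on {-1..1} q"
    unfolding q_def
    by (rule continuous_on_compose2[OF M])
       (auto intro!: continuous_intros arccos_ubound order.trans[OF _ arccos_lbound])
  have Mq: "M x = q (cos x)" if "x \<in> {-pi..pi}" for x
    using that by (cases "x \<ge> 0") (auto simp: q_def M_def arccos_cos arccos_cos2)
  define I where "I = integral {-pi..pi} (\<lambda>x. \<bar>M x\<bar>)"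
  \<comment> \<open>Subtracting a polynomial in \<open>cos x\<close> from one factor
    \<open>M\<close> costs nothing, by orthogonality, and leaves \<open>M\<close> times an error
    below \<open>e\<close>.\<close>
  have bound: "integral {-pi..pi} (\<lambda>x. M x * M x) \<le> e * I" if e: "e > 0" for e
  proof -
    obtain p where p: "real_polynomial_function p" and pq: "\<And>y. y \<in> {-1..1} \<Longrightarrow> \<bar>q y - p y\<bar> < e"
      using Stone_Weierstrass_real_polynomial_function[OF compact_Icc q e] by blast
    obtain a n where pa: "p = (\<lambda>y. \<Sum>i\<le>n. a i * y ^ i)"
      using p by (auto simp: real_polynomial_function_iff_sum)
    have pc: "continuous_on {-pi..pi} (\<lambda>x. p (cos x))"
      unfolding pa by (intro continuous_intros)
    have "integral {-pi..pi} (\<lambda>x. M x * p (cos x)) =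
        integral {-pi..pi} (\<lambda>x. \<Sum>i\<le>n. a i * (M x * cos x ^ i))"
      by (simp add: pa sum_distrib_left algebra_simps)
    also have "\<dots> = (\<Sum>i\<le>n. integral {-pi..pi} (\<lambda>x. a i * (M x * cos x ^ i)))"
      by (rule integral_sum) (auto intro!: Mint continuous_intros M)
    also have "\<dots> = 0" by (simp add: Morth)
    finally have "integral {-pi..pi} (\<lambda>x. M x * M x) = integral {-pi..pi} (\<lambda>x. M x * M x - M x * p (cos x))"
      by (subst integral_diff) (auto intro!: Mint continuous_intros M pc)
    also have "\<dots> \<le> integral {-pi..pi} (\<lambda>x. e * \<bar>M x\<bar>)"
    proof (rule integral_le)
      fix x assume x: "x \<in> {-pi..pi}"
      have "M x * M x - M x * p (cos x) \<le> \<bar>M x\<bar> * \<bar>q (cos x) - p (cos x)\<bar>"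
        unfolding Mq[OF x, symmetric] abs_mult[symmetric] right_diff_distrib[symmetric]
        by (rule abs_ge_self)
      also have "\<dots> \<le> \<bar>M x\<bar> * e"
        by (rule mult_left_mono[OF less_imp_le[OF pq]]) simp_all
      finally show "M x * M x - M x * p (cos x) \<le> e * \<bar>M x\<bar>" by (simp only: mult.commute)
    qed (auto intro!: Mint continuous_intros M pc)
    finally show ?thesis by (simp add: I_def)
  qed
  have "integral {-pi..pi} (\<lambda>x. M x * M x) \<le> 0"
  proof (rule field_le_epsilon)
    fix d :: real assume "d > 0"
    have I0: "I \<ge> 0" unfolding I_def by (intro integral_nonneg Mint continuous_intros M) auto
    \<comment> \<open>The denominator \<open>I + 1\<close> covers the case
      \<open>I = 0\<close>.\<close>
    have "integral {-pi..pi} (\<lambda>x. M x * M x) \<le> d / (I + 1) * I"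
      by (rule bound) (use I0 \<open>d > 0\<close> in auto)
    also have "\<dots> \<le> d" using I0 \<open>d > 0\<close> by (simp add: field_simps)
    finally show "integral {-pi..pi} (\<lambda>x. M x * M x) \<le> 0 + d" by simp
  qed
  moreover have "integral {-pi..pi} (\<lambda>x. M x * M x) \<ge> 0"
    by (intro integral_nonneg Mint continuous_intros M) auto
  ultimately have "integral {-pi..pi} (\<lambda>x. M x * M x) = 0" by simp
  moreover have "-pi < pi" using pi_gt_zero by linarith
  moreover have "continuous_on {-pi..pi} (\<lambda>x. M x * M x)" by (intro continuous_intros M)
  ultimately have "\<forall>x\<in>{-pi..pi}. M x * M x = 0"
    using integral_eq_0_iff[of "-pi" pi "\<lambda>x. M x * M x"] zero_le_square by blast
  then show ?thesis using x by (auto simp: M_def)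
qed

text \<open>Prepares \<open>h\<close> times a basis function for
  \<open>even_part_zero_if_orthogonal_cos_powers\<close>. Each factor \<open>cos x\<close> is traded
  for the two neighbouring frequencies, so the induction must run over all \<open>k\<close> at
  once.\<close>

lemma integral_hcos_times_cos_power_eq_0:
  fixes h :: "real \<Rightarrow> real"
  assumes h: "continuous_on {-pi..pi} h"
    and orth: "\<And>k. integral {-pi..pi} (\<lambda>x. h x * hcos \<theta> k x) = 0"
    and refl: "cos \<theta> = 0 \<or> sin \<theta> = 0"
  shows "integral {-pi..pi} (\<lambda>x. h x * hcos \<theta> k x * cos x ^ n) = 0"
proof (induction n arbitrary: k)
  case 0
  then show ?case by (simp add: orth)
next
  case (Suc n)
  \<comment> \<open>For \<open>k = 0\<close> the lower neighbour has frequency -1/2. As \<theta> is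
    a multiple of pi/2, the functions are even or odd, so this is \<open>hcos \<theta> 0\<close> up
    to sign.\<close>
  have "\<exists>c j. \<forall>x. cos ((real k - 1/2) * x - \<theta>) = c * hcos \<theta> j x"
  proof (cases k)
    case 0
    define s :: real where "s = (if sin \<theta> = 0 then 1 else -1)"
    have "cos ((real k - 1/2) * x - \<theta>) = s * hcos \<theta> 0 x" for x
      using refl 0 by (auto simp: s_def hcos_def cos_diff)
    then show ?thesis by blast
  next
    case (Suc j)
    have "cos ((real k - 1/2) * x - \<theta>) = 1 * hcos \<theta> j x" for x
      by (simp add: Suc hcos_def add.commute)
    then show ?thesis by blast
  qed
  then obtain c j where cj: "\<And>x. cos ((real k - 1/2) * x - \<theta>) = c * hcos \<theta> j x" by blast
  have "h x * hcos \<theta> k x * cos x ^ Suc n =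
      (1/2) * (h x * hcos \<theta> (Suc k) x * cos x ^ n) + (c/2) * (h x * hcos \<theta> j x * cos x ^ n)" for x
  proof -
    have "cos x * hcos \<theta> k x = (hcos \<theta> (Suc k) x + c * hcos \<theta> j x) / 2"
      unfolding cos_times_hcos cj by (simp add: hcos_def add.commute)
    then have "h x * (cos x * hcos \<theta> k x) * cos x ^ n = h x * ((hcos \<theta> (Suc k) x + c * hcos \<theta> j x) / 2) * cos x ^ n"
      by simp
    then show ?thesis by (simp add: algebra_simps add_divide_distrib)
  qed
  then show ?case
    by (simp only:, subst integral_add)
       (auto intro!: integrable_continuous_real continuous_intros h simp: Suc.IH)
qed

text \<open>The even parts of \<open>h x * cos (x/2)\<close> and \<open>h x * sin (x/2)\<close>
  vanish; this kills \<open>h x + h (-x)\<close> and \<open>h x - h (-x)\<close> wherever the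
  trigonometric factor is nonzero.\<close>

lemma half_integer_trig_complete:
  fixes h :: "real \<Rightarrow> real"
  assumes h: "continuous_on {-pi..pi} h"
    and orth: "\<And>k. integral {-pi..pi} (\<lambda>x. h x * hcos 0 k x) = 0"
              "\<And>k. integral {-pi..pi} (\<lambda>x. h x * hcos (pi/2) k x) = 0"
    and x: "x \<in> {-pi..pi}"
  shows "h x = 0"
proof -
  have zero: "h x * hcos \<theta> 0 x + h (-x) * hcos \<theta> 0 (-x) = 0"
    if "\<theta> = 0 \<or> \<theta> = pi/2" "x \<in> {-pi..pi}" for \<theta> x
  proof (rule even_part_zero_if_orthogonal_cos_powers[where K = "\<lambda>x. h x * hcos \<theta> 0 x"])
    have "cos \<theta> = 0 \<or> sin \<theta> = 0" using that(1) cos_pi_half by fastforce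
    moreover have "integral {-pi..pi} (\<lambda>x. h x * hcos \<theta> k x) = 0" for k
      using that(1) orth by blast
    ultimately show "integral {-pi..pi} (\<lambda>x. h x * hcos \<theta> 0 x * cos x ^ n) = 0" for n
      using integral_hcos_times_cos_power_eq_0[OF h] by blast
  qed (use that in \<open>auto intro!: continuous_intros h\<close>)
  \<comment> \<open>At the endpoints \<open>cos (x/2)\<close> vanishes, so they are recovered by
    continuity afterwards. At \<open>x = 0\<close> the sine gives nothing, but the even part alone
    suffices.\<close>
  have inner: "h x = 0" if x: "x \<in> {-pi<..<pi}" for x
  proof -
    have "cos (x/2) > 0" by (rule cos_gt_zero_pi) (use x in auto)
    moreover have "(h x + h (-x)) * cos (x/2) = 0"
      using zero[of 0 x] x by (simp add: hcos_0 algebra_simps)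
    ultimately have even: "h x + h (-x) = 0" by simp
    show ?thesis
    proof (cases "x = 0")
      case False
      have "sin (x/2) \<noteq> 0"
        using False x sin_gt_zero[of "x/2"] sin_gt_zero[of "-x/2"] by (cases "x > 0") auto
      moreover have "(h x - h (-x)) * sin (x/2) = 0"
        using zero[of "pi/2" x] x by (simp add: hcos_pi_half algebra_simps)
      ultimately show ?thesis using even by simp
    qed (use even in simp)
  qed
  have "closure {-pi<..<pi} = {-pi..pi}" by (simp add: closure_greaterThanLessThan)
  then show ?thesis
    using continuous_constant_on_closure[of "{-pi<..<pi}" h 0 x] h inner x by simp
qed

subsection \<open>Integration by parts\<close>

lemma integral_by_parts_real:
  fixes f g f' g' :: "real \<Rightarrow> real"
  assumes "a \<le> b"
    and f: "\<And>x. x \<in> {a..b} \<Longrightarrow> (f has_real_derivative f' x) (at x within {a..b})"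
    and g: "\<And>x. x \<in> {a..b} \<Longrightarrow> (g has_real_derivative g' x) (at x within {a..b})"
    and f': "continuous_on {a..b} f'" and g': "continuous_on {a..b} g'"
  shows "integral {a..b} (\<lambda>x. f' x * g x) = f b * g b - f a * g a - integral {a..b} (\<lambda>x. f x * g' x)"
proof -
  have c: "continuous_on {a..b} f" "continuous_on {a..b} g"
    using f g DERIV_continuous_on by blast+
  have "((\<lambda>x. f' x * g x + f x * g' x) has_integral f b * g b - f a * g a) {a..b}"
    by (rule fundamental_theorem_of_calculus[OF \<open>a \<le> b\<close>])
      (auto intro!: derivative_eq_intros f g simp flip: has_real_derivative_iff_has_vector_derivative)
  then have "integral {a..b} (\<lambda>x. f' x * g x + f x * g' x) = f b * g b - f a * g a"
    by (rule integral_unique)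
  then show ?thesis
    by (subst (asm) integral_add) (auto intro!: integrable_continuous_real continuous_intros c f' g')
qed

text \<open>Both factors are anti-periodic, so their product agrees at the two ends and the boundary
  terms cancel.\<close>

lemma integral_hcos_by_parts:
  assumes g: "\<And>x. x \<in> {-pi..pi} \<Longrightarrow> (g has_real_derivative g1 x) (at x within {-pi..pi})"
    and g1: "continuous_on {-pi..pi} g1"
    and anti: "g (-pi) = - g pi"
  shows "integral {-pi..pi} (\<lambda>x. g x * hcos \<theta> k x) =
    - (1 / (real k + 1/2)) * integral {-pi..pi} (\<lambda>x. g1 x * hcos (\<theta> + pi/2) k x)"
proof -
  have "integral {-pi..pi} (\<lambda>x. g1 x * hcos (\<theta> + pi/2) k x) =
     - integral {-pi..pi} (\<lambda>x. g x * ((real k + 1/2) * hcos (\<theta> + pi/2 - pi/2) k x))"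
    using integral_by_parts_real[OF _ g has_real_derivative_hcos[of "\<theta> + pi/2" k] g1] anti
    by (simp add: hcos_antiperiodic continuous_on_hcos continuous_on_mult_left)
  also have "integral {-pi..pi} (\<lambda>x. g x * ((real k + 1/2) * hcos (\<theta> + pi/2 - pi/2) k x)) =
      (real k + 1/2) * integral {-pi..pi} (\<lambda>x. g x * hcos \<theta> k x)"
    by (simp add: mult.left_commute[of _ "real k + 1/2"] del: distrib_right distrib_left)
  finally show ?thesis
    by (simp add: field_simps add_nonneg_pos)
qed

text \<open>The interval has finite measure and
  \<open>\<bar>y\<bar> \<le> 1 + y\<^sup>2\<close>.\<close>

lemma set_integrable_of_square:
  fixes g :: "real \<Rightarrow> real"
  assumes m: "set_borel_measurable lborel {a..b} g"
    and sq: "set_integrable lborel {a..b} (\<lambda>x. (g x)\<^sup>2)"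
  shows "set_integrable lborel {a..b} g"
proof (rule set_integrable_bound)
  have "set_integrable lborel {a..b} (\<lambda>x. 1 :: real)"
    by (rule borel_integrable_atLeastAtMost') simp
  then show "set_integrable lborel {a..b} (\<lambda>x. 1 + (g x)\<^sup>2)"
    using sq by (rule set_integral_add)
  have "\<bar>y\<bar> \<le> 1 + y\<^sup>2" for y :: real
    using zero_le_power2[of "\<bar>y\<bar> - 1"] zero_le_power2[of y] by (auto simp: power2_diff)
  then show "AE x in lborel. x \<in> {a..b} \<longrightarrow> norm (g x) \<le> norm (1 + (g x)\<^sup>2)"
    by (intro AE_I2 impI) (metis abs_of_nonneg add_nonneg_nonneg real_norm_def zero_le_one zero_le_power2)
qed (rule m)

lemma set_integrable_mult_continuous:
  fixes g c :: "real \<Rightarrow> real"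
  assumes g: "set_integrable lborel {a..b} g" and c: "continuous_on {a..b} c"
  shows "set_integrable lborel {a..b} (\<lambda>x. g x * c x)"
proof -
  have "bounded (c ` {a..b})"
    by (intro compact_imp_bounded compact_continuous_image c compact_Icc)
  then have "\<exists>B. \<forall>x\<in>{a..b}. \<bar>c x\<bar> \<le> B" by (simp add: bounded_iff)
  then obtain B where B: "\<And>x. x \<in> {a..b} \<Longrightarrow> \<bar>c x\<bar> \<le> B" by blast
  have gm: "(\<lambda>x. indicator {a..b} x * g x) \<in> borel_measurable lborel"
    using borel_measurable_integrable[OF g[unfolded set_integrable_def]] by simp
  have cm: "(\<lambda>x. indicator {a..b} x * c x) \<in> borel_measurable lborel"
    using borel_measurable_integrable[OF borel_integrable_atLeastAtMost'[OF c, unfolded set_integrable_def]]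
    by simp
  have "(\<lambda>x. (indicator {a..b} x * g x) * (indicator {a..b} x * c x)) \<in> borel_measurable lborel"
    by (rule borel_measurable_times[OF gm cm])
  moreover have "(indicator {a..b} x * g x) * (indicator {a..b} x * c x) = indicator {a..b} x *\<^sub>R (g x * c x)" for x
    by (simp add: indicator_def)
  ultimately have "set_borel_measurable lborel {a..b} (\<lambda>x. g x * c x)"
    by (simp only: set_borel_measurable_def)
  moreover have "set_integrable lborel {a..b} (\<lambda>x. B * g x)"
    using g by simp
  moreover have "norm (g x * c x) \<le> norm (B * g x)" if "x \<in> {a..b}" for x
  proof -
    have "\<bar>g x\<bar> * \<bar>c x\<bar> \<le> \<bar>g x\<bar> * B" by (intro mult_left_mono B that) auto
    also have "\<dots> \<le> \<bar>g x\<bar> * \<bar>B\<bar>" by (rule mult_left_mono) auto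
    finally show ?thesis by (simp add: abs_mult mult.commute)
  qed
  ultimately show ?thesis
    by (intro set_integrable_bound[of lborel "{a..b}" "\<lambda>x. B * g x" "\<lambda>x. g x * c x"] AE_I2 impI)
qed

text \<open>Integration by parts for the absolutely continuous function with density \<open>g'\<close>,
  obtained from Fubini's theorem on the triangle \<open>a \<le> y \<le> x \<le> b\<close>.\<close>
lemma integral_by_parts_absolutely_continuous:
  fixes g g' c d :: "real \<Rightarrow> real"
  assumes "a \<le> b"
    and g': "set_integrable lborel {a..b} g'"
    and g: "\<And>x. x \<in> {a..b} \<Longrightarrow> g x = g a + (LBINT y:{a..x}. g' y)"
    and c: "\<And>x. x \<in> {a..b} \<Longrightarrow> (c has_real_derivative d x) (at x within {a..b})"
    and d: "continuous_on {a..b} d"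
  shows "(LBINT x:{a..b}. g x * d x) = g b * c b - g a * c a - (LBINT y:{a..b}. g' y * c y)"
proof -
  define G where "G y = indicator {a..b} y * g' y" for y
  define D where "D x = indicator {a..b} x * d x" for x
  have Gi: "integrable lborel G" using g' by (simp add: set_integrable_def G_def[abs_def])
  have Di: "integrable lborel D"
    using borel_integrable_atLeastAtMost'[OF d] by (simp add: set_integrable_def D_def[abs_def])
  have Gm: "G \<in> borel_measurable borel" and Dm: "D \<in> borel_measurable borel"
    using borel_measurable_integrable[OF Gi] borel_measurable_integrable[OF Di] by simp_all
  note [measurable] = Gm Dm
  define F where "F = (\<lambda>(x, y). D x * G y)"
  have Fi: "integrable (lborel \<Otimes>\<^sub>M lborel) F"
  proof (rule lborel_pair.Fubini_integrable)
    show "F \<in> borel_measurable (lborel \<Otimes>\<^sub>M lborel)" unfolding F_def by (simp cong: measurable_cong_sets)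
    have "(\<integral> y. norm (F (x, y)) \<partial>lborel) = \<bar>D x\<bar> * (\<integral> y. \<bar>G y\<bar> \<partial>lborel)" for x
      by (simp add: F_def abs_mult)
    then show "integrable lborel (\<lambda>x. \<integral> y. norm (F (x, y)) \<partial>lborel)" using Di by simp
    show "AE x in lborel. integrable lborel (\<lambda>y. F (x, y))" using Gi by (simp add: F_def)
  qed
  \<comment> \<open>\<open>H\<close> cuts the product down to the triangle. Integrating out
    \<open>y\<close> leaves an increment of \<open>g\<close>, integrating out \<open>x\<close> an
    increment of \<open>c\<close>.\<close>
  define H where "H = (\<lambda>(x, y). indicator {p. snd p \<le> fst p} (x, y) * F (x, y))"
  have Hi: "integrable (lborel \<Otimes>\<^sub>M lborel) H"
  proof -
    have "closed {p :: real \<times> real. snd p \<le> fst p}"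
      by (intro closed_Collect_le continuous_intros)
    then have "{p. snd p \<le> fst p} \<in> sets (lborel \<Otimes>\<^sub>M lborel :: (real \<times> real) measure)"
      unfolding lborel_prod sets_lborel by (rule borel_closed)
    from integrable_real_mult_indicator[OF this Fi] show ?thesis
      by (simp add: H_def case_prod_beta' mult.commute)
  qed
  have inner1: "(\<integral> y. H (x, y) \<partial>lborel) = D x * (g x - g a)" for x
  proof (cases "x \<in> {a..b}")
    case True
    have "H (x, y) = D x * (indicator {a..x} y * g' y)" for y
      using True by (auto simp: H_def F_def G_def indicator_def)
    then have "(\<integral> y. H (x, y) \<partial>lborel) = D x * (LBINT y:{a..x}. g' y)"
      by (simp add: set_lebesgue_integral_def)
    then show ?thesis using g[OF True] by simp
  qed (simp add: H_def F_def D_def)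
  have inner2: "(\<integral> x. H (x, y) \<partial>lborel) = G y * (c b - c y)" for y
  proof (cases "y \<in> {a..b}")
    case True
    have "(\<integral> x. H (x, y) \<partial>lborel) = (\<integral> x. G y * (indicator {y..b} x * d x) \<partial>lborel)"
      by (rule Bochner_Integration.integral_cong)
        (use True in \<open>auto simp: H_def F_def D_def indicator_def\<close>)
    also have "\<dots> = G y * (LBINT x:{y..b}. d x)"
      by (simp add: set_lebesgue_integral_def)
    also have "(LBINT x:{y..b}. d x) = integral {y..b} d"
      by (rule set_borel_integral_eq_integral, rule borel_integrable_atLeastAtMost',
          rule continuous_on_subset[OF d]) (use True in auto)
    also have "\<dots> = c b - c y"
    proof (rule integral_unique, rule fundamental_theorem_of_calculus)
      fix x assume x: "x \<in> {y..b}"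
      show "(c has_vector_derivative d x) (at x within {y..b})"
        unfolding has_real_derivative_iff_has_vector_derivative[symmetric]
        by (rule DERIV_subset[OF c]) (use True x in auto)
    qed (use True in auto)
    finally show ?thesis .
  qed (simp add: H_def F_def G_def)
  have "(\<integral> x. (\<integral> y. H (x, y) \<partial>lborel) \<partial>lborel) = (\<integral> y. (\<integral> x. H (x, y) \<partial>lborel) \<partial>lborel)"
    using lborel_pair.Fubini_integral[of "\<lambda>x y. H (x, y)"] Hi by simp
  then have eq: "(\<integral> x. D x * (g x - g a) \<partial>lborel) = (\<integral> y. G y * (c b - c y) \<partial>lborel)"
    by (simp add: inner1 inner2)
  have cc: "continuous_on {a..b} c" using c DERIV_continuous_on by blast
  have Gc: "(\<integral> y. G y * (c b - c y) \<partial>lborel) = (g b - g a) * c b - (LBINT y:{a..b}. g' y * c y)"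
  proof -
    have "(\<integral> y. G y * (c b - c y) \<partial>lborel) = (LBINT y:{a..b}. g' y * c b - g' y * c y)"
      by (simp add: set_lebesgue_integral_def G_def right_diff_distrib mult.assoc)
    also have "\<dots> = (LBINT y:{a..b}. g' y * c b) - (LBINT y:{a..b}. g' y * c y)"
      by (rule set_integral_diff) (use g' set_integrable_mult_continuous[OF g' cc] in auto)
    finally show ?thesis using g[of b] \<open>a \<le> b\<close> by simp
  qed
  \<comment> \<open>Fubini's theorem delivers the measurability hidden in this claim;
    \<open>g\<close> is given only through its increments.\<close>
  have id: "integrable lborel (\<lambda>x. D x * (g x - g a))"
    using lborel_pair.integrable_fst[of "\<lambda>x y. H (x, y)"] Hi by (simp add: inner1)
  have "(LBINT x:{a..b}. g x * d x) = (\<integral> x. D x * (g x - g a) + g a * D x \<partial>lborel)"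
    by (simp add: set_lebesgue_integral_def D_def algebra_simps)
  also have "\<dots> = (\<integral> x. D x * (g x - g a) \<partial>lborel) + g a * (LBINT x:{a..b}. d x)"
    using id Di by (simp add: set_lebesgue_integral_def flip: D_def)
  also have "(LBINT x:{a..b}. d x) = c b - c a"
  proof -
    have "(LBINT x:{a..b}. d x) = integral {a..b} d"
      by (rule set_borel_integral_eq_integral, rule borel_integrable_atLeastAtMost', rule d)
    also have "\<dots> = c b - c a"
      by (rule integral_unique, rule fundamental_theorem_of_calculus)
        (use \<open>a \<le> b\<close> c in \<open>auto simp flip: has_real_derivative_iff_has_vector_derivative\<close>)
    finally show ?thesis .
  qed
  finally show ?thesis unfolding eq Gc by (simp add: algebra_simps)
qed

subsection \<open>Coefficients of admissible data\<close>

text \<open>Two classical integrations by parts and one for the absolutely continuous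
  \<open>g2\<close> each give a factor \<open>- 1 / (k + 1/2)\<close> and a phase shift by pi/2.
  Reducing the total shift by pi supplies a fourth minus sign, so the result is positive with phase
  \<open>\<theta> + pi/2\<close>.\<close>

lemma integral_hcos_admissible:
  assumes "admissible_data g g1 g2 g3"
  shows "integral {-pi..pi} (\<lambda>x. g x * hcos \<theta> k x) =
    (1 / (real k + 1/2) ^ 3) * (LBINT x:{-pi..pi}. g3 x * hcos (\<theta> + pi/2) k x)"
proof -
  let ?l = "real k + 1/2"
  have l: "?l > 0" by (simp add: add_nonneg_pos)
  have g: "\<And>x. x \<in> {-pi..pi} \<Longrightarrow> (g has_real_derivative g1 x) (at x within {-pi..pi})"
    and g1: "\<And>x. x \<in> {-pi..pi} \<Longrightarrow> (g1 has_real_derivative g2 x) (at x within {-pi..pi})"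
    and g2: "continuous_on {-pi..pi} g2"
    and m: "set_borel_measurable lborel {-pi..pi} g3"
    and sq: "set_integrable lborel {-pi..pi} (\<lambda>x. (g3 x)\<^sup>2)"
    and ac: "\<And>x. x \<in> {-pi..pi} \<Longrightarrow> g2 x = g2 (-pi) + (LBINT y:{-pi..x}. g3 y)"
    and anti: "g (-pi) = - g pi" "g1 (-pi) = - g1 pi" "g2 (-pi) = - g2 pi"
    using assms unfolding admissible_data_def by blast+
  have c1: "continuous_on {-pi..pi} g1" using g1 DERIV_continuous_on by blast
  have "(LBINT x:{-pi..pi}. g2 x * (?l * hcos (\<theta> + pi/2 - pi/2) k x)) =
      g2 pi * hcos (\<theta> + pi/2) k pi - g2 (-pi) * hcos (\<theta> + pi/2) k (-pi)
      - (LBINT y:{-pi..pi}. g3 y * hcos (\<theta> + pi/2) k y)"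
  proof (rule integral_by_parts_absolutely_continuous)
    show "continuous_on {-pi..pi} (\<lambda>x. ?l * hcos (\<theta> + pi/2 - pi/2) k x)" by (intro continuous_intros)
    show "(hcos (\<theta> + pi/2) k has_real_derivative ?l * hcos (\<theta> + pi/2 - pi/2) k x) (at x within {-pi..pi})" for x
      by (rule has_real_derivative_hcos)
    show "g2 x = g2 (-pi) + (LBINT y:{-pi..x}. g3 y)" if "x \<in> {-pi..pi}" for x
      by (rule ac[OF that])
    show "set_integrable lborel {-pi..pi} g3" by (rule set_integrable_of_square[OF m sq])
  qed simp
  also have "g2 pi * hcos (\<theta> + pi/2) k pi - g2 (-pi) * hcos (\<theta> + pi/2) k (-pi) = 0"
    by (simp only: anti hcos_antiperiodic minus_mult_minus diff_self)
  also have "(LBINT x:{-pi..pi}. g2 x * (?l * hcos (\<theta> + pi/2 - pi/2) k x)) =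
      ?l * (LBINT x:{-pi..pi}. g2 x * hcos \<theta> k x)"
    by (simp only: add_diff_cancel_right' mult.left_commute[of _ ?l] set_integral_mult_right)
  also have "(LBINT x:{-pi..pi}. g2 x * hcos \<theta> k x) = integral {-pi..pi} (\<lambda>x. g2 x * hcos \<theta> k x)"
    by (intro set_borel_integral_eq_integral borel_integrable_atLeastAtMost' continuous_intros g2)
  finally have "?l * integral {-pi..pi} (\<lambda>x. g2 x * hcos \<theta> k x) =
      - (LBINT y:{-pi..pi}. g3 y * hcos (\<theta> + pi/2) k y)"
    by (simp only: diff_0)
  moreover have "b = - (1 / ?l) * c" if "?l * b = - c" for b c
    using that l by (simp add: field_simps)
  ultimately have "integral {-pi..pi} (\<lambda>x. g2 x * hcos \<theta> k x) =
      - (1 / ?l) * (LBINT y:{-pi..pi}. g3 y * hcos (\<theta> + pi/2) k y)"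
    by blast
  moreover have "integral {-pi..pi} (\<lambda>x. g x * hcos \<theta> k x) =
      - (1 / ?l) * (- (1 / ?l) * integral {-pi..pi} (\<lambda>x. g2 x * hcos (\<theta> + pi/2 + pi/2) k x))"
    using integral_hcos_by_parts[OF g c1 anti(1), of \<theta> k]
      integral_hcos_by_parts[OF g1 g2 anti(2), of "\<theta> + pi/2" k] by simp
  moreover have "hcos (\<theta> + pi/2 + pi/2) k x = - hcos \<theta> k x" for x
    using hcos_add_pi[of \<theta> k x] by (simp add: add.assoc)
  ultimately show ?thesis
    by (simp add: power3_eq_cube)
qed

text \<open>Bessel's inequality, from expanding the integral of \<open>(g x - p x)\<^sup>2\<close>
  with \<open>p\<close> the partial sum. The factor \<open>1 / pi\<close> normalises, pi being the
  squared norm of each \<open>hcos \<theta> k\<close>.\<close>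

lemma summable_hcos_coefficient_squares:
  fixes g :: "real \<Rightarrow> real" and \<theta> :: real
  assumes m: "set_borel_measurable lborel {-pi..pi} g"
    and sq: "set_integrable lborel {-pi..pi} (\<lambda>x. (g x)\<^sup>2)"
  defines "c \<equiv> (\<lambda>k. (1 / pi) * (LBINT x:{-pi..pi}. g x * hcos \<theta> k x))"
  shows "summable (\<lambda>k. (c k)\<^sup>2)"
proof (rule summableI_nonneg_bounded)
  fix n
  define p where "p x = (\<Sum>k<n. c k * hcos \<theta> k x)" for x
  have p: "continuous_on {-pi..pi} p" unfolding p_def by (intro continuous_intros)
  have gi: "set_integrable lborel {-pi..pi} (\<lambda>x. g x * f x)" if "continuous_on {-pi..pi} f" for f
    by (rule set_integrable_mult_continuous[OF set_integrable_of_square[OF m sq] that])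
  have ci: "set_integrable lborel {-pi..pi} f" if "continuous_on {-pi..pi} f" for f :: "real \<Rightarrow> real"
    using that by (rule borel_integrable_atLeastAtMost')
  have lin: "(LBINT x:{-pi..pi}. h x * p x) = (\<Sum>k<n. c k * (LBINT x:{-pi..pi}. h x * hcos \<theta> k x))"
    if "\<And>k. set_integrable lborel {-pi..pi} (\<lambda>x. h x * hcos \<theta> k x)" for h
  proof -
    have "(LBINT x:{-pi..pi}. h x * p x) = (LBINT x:{-pi..pi}. \<Sum>k<n. c k * (h x * hcos \<theta> k x))"
      by (simp only: p_def sum_distrib_left mult.left_commute)
    also have "\<dots> = (\<Sum>k<n. LBINT x:{-pi..pi}. c k * (h x * hcos \<theta> k x))"
      unfolding set_lebesgue_integral_def scaleR_sum_right
    proof (rule Bochner_Integration.integral_sum)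
      fix k
      have "set_integrable lborel {-pi..pi} (\<lambda>x. c k * (h x * hcos \<theta> k x))"
        by (rule set_integrable_mult_right) (rule that)
      then show "integrable lborel (\<lambda>x. indicator {-pi..pi} x *\<^sub>R (c k * (h x * hcos \<theta> k x)))"
        by (simp only: set_integrable_def)
    qed
    finally show ?thesis by (simp only: set_integral_mult_right)
  qed
  have gp: "(LBINT x:{-pi..pi}. g x * p x) = pi * (\<Sum>k<n. (c k)\<^sup>2)"
  proof -
    have "c k * (LBINT x:{-pi..pi}. g x * hcos \<theta> k x) = pi * (c k)\<^sup>2" for k
      by (simp add: c_def power2_eq_square)
    then show ?thesis
      by (subst lin) (auto intro!: gi continuous_intros simp: sum_distrib_left)
  qed
  have pe: "(LBINT x:{-pi..pi}. p x * hcos \<theta> k x) = pi * c k" if "k < n" for k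
  proof -
    have "(LBINT x:{-pi..pi}. hcos \<theta> k x * p x) = (\<Sum>j<n. c j * (LBINT x:{-pi..pi}. hcos \<theta> k x * hcos \<theta> j x))"
      by (rule lin) (intro ci continuous_intros)
    also have "\<dots> = (\<Sum>j<n. c j * integral {-pi..pi} (\<lambda>x. hcos \<theta> k x * hcos \<theta> j x))"
      by (intro sum.cong refl arg_cong2[where f = "(*)"] set_borel_integral_eq_integral ci continuous_intros)
    also have "\<dots> = (\<Sum>j<n. if k = j then c j * pi else 0)"
      by (intro sum.cong refl) (simp add: hcos_orthogonal)
    finally show ?thesis using that by (simp add: mult.commute)
  qed
  have pp: "(LBINT x:{-pi..pi}. p x * p x) = pi * (\<Sum>k<n. (c k)\<^sup>2)"
    by (subst lin) (auto intro!: ci continuous_intros p simp: pe sum_distrib_left power2_eq_square mult_ac)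
  have "0 \<le> (LBINT x:{-pi..pi}. (g x - p x)\<^sup>2)"
    unfolding set_lebesgue_integral_def by (rule Bochner_Integration.integral_nonneg) simp
  also have "\<dots> = (LBINT x:{-pi..pi}. (g x)\<^sup>2 - 2 * (g x * p x) + p x * p x)"
    by (simp add: power2_eq_square algebra_simps)
  also have "\<dots> = (LBINT x:{-pi..pi}. (g x)\<^sup>2) - 2 * (LBINT x:{-pi..pi}. g x * p x) + (LBINT x:{-pi..pi}. p x * p x)"
  proof -
    have i: "set_integrable lborel {-pi..pi} (\<lambda>x. 2 * (g x * p x))" using gi[OF p] by simp
    show ?thesis
      by (simp add: set_integral_add(2)[OF set_integral_diff(1)[OF sq i] ci[OF continuous_on_mult[OF p p]]]
          set_integral_diff(2)[OF sq i])
  qed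
  finally have "pi * (\<Sum>k<n. (c k)\<^sup>2) \<le> (LBINT x:{-pi..pi}. (g x)\<^sup>2)"
    by (simp add: gp pp)
  then show "(\<Sum>k<n. (c k)\<^sup>2) \<le> (LBINT x:{-pi..pi}. (g x)\<^sup>2) / pi"
    by (simp add: field_simps)
qed simp

text \<open>With \<open>u = 1 / (k + 1/2)\<close>, the inequality
  \<open>2 * \<bar>c\<bar> * u \<le> c\<^sup>2 + u\<^sup>2\<close> reduces the claim to two summable
  series of squares.\<close>

lemma summable_hcos_coefficient_over_frequency:
  fixes c :: "nat \<Rightarrow> real"
  assumes "summable (\<lambda>k. (c k)\<^sup>2)"
  shows "summable (\<lambda>k. \<bar>c k\<bar> / (real k + 1/2))"
proof (rule summable_comparison_test')
  have "summable (\<lambda>k. inverse (real (Suc k) ^ 2))"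
    using inverse_power_summable[of 2, where 'a = real] by (subst summable_Suc_iff) simp
  then show "summable (\<lambda>k. (c k)\<^sup>2 + 4 * inverse (real (Suc k) ^ 2))"
    using assms by (intro summable_add summable_mult)
  show "norm (\<bar>c k\<bar> / (real k + 1/2)) \<le> (c k)\<^sup>2 + 4 * inverse (real (Suc k) ^ 2)" if "k \<ge> 0" for k
  proof -
    define u v where "u = 1 / (real k + 1/2)" and "v = inverse (real (Suc k))"
    have "0 \<le> (\<bar>c k\<bar> - u)\<^sup>2" by simp
    then have "2 * (\<bar>c k\<bar> * u) \<le> (c k)\<^sup>2 + u\<^sup>2" by (simp add: power2_diff)
    moreover have "u > 0" by (simp add: u_def add_nonneg_pos)
    then have "\<bar>c k\<bar> * u \<le> 2 * (\<bar>c k\<bar> * u)" by simp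
    \<comment> \<open>Equality holds at \<open>k = 0\<close>; squaring gives the 4 in the
      majorant.\<close>
    moreover have "u \<le> 2 * v" by (simp add: u_def v_def field_simps)
    then have "u\<^sup>2 \<le> (2 * v)\<^sup>2" using \<open>u > 0\<close> by (intro power_mono) auto
    ultimately have "\<bar>c k\<bar> * u \<le> (c k)\<^sup>2 + (2 * v)\<^sup>2" by linarith
    moreover have "norm (\<bar>c k\<bar> / (real k + 1/2)) = \<bar>c k\<bar> * u" by (simp add: u_def)
    moreover have "(2 * v)\<^sup>2 = 4 * inverse (real (Suc k) ^ 2)"
      by (simp add: v_def power_mult_distrib power_inverse)
    ultimately show ?thesis by (simp only:)
  qed
qed

subsection \<open>Half-integer Fourier series\<close>

text \<open>\<open>C\<close> holds coefficients of third derivatives and \<open>a\<close> the time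
  amplitudes. The exponent \<open>p\<close> records the remaining smoothness: an x-derivative lowers
  it by one, a t-derivative by two. So \<open>u\<close> has \<open>p = 3\<close>, its x-derivative
  2, and the series in the equation and in \<open>f\<close> have 1.\<close>

definition hseries :: "(nat \<Rightarrow> real) \<Rightarrow> nat \<Rightarrow> real \<Rightarrow> (nat \<Rightarrow> real \<Rightarrow> real) \<Rightarrow> real \<times> real \<Rightarrow> real" where
  "hseries C p \<theta> a = (\<lambda>(x, t). \<Sum>k. a k t * (C k / (real k + 1/2) ^ p) * hcos \<theta> k x)"

text \<open>One factor \<open>1 / (k + 1/2)\<close> is kept for summability; each of the other
  \<open>p\<close> factors is at most 2.\<close>

lemma hseries_term_bound:
  fixes \<alpha> c B :: real
  assumes "\<bar>\<alpha>\<bar> \<le> B"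
  shows "norm (\<alpha> * (c / (real k + 1/2) ^ Suc p) * hcos \<theta> k x) \<le> B * 2 ^ p * (\<bar>c\<bar> / (real k + 1/2))"
proof -
  let ?l = "real k + 1/2"
  have l: "?l > 0" by (simp add: add_nonneg_pos)
  have "1 / ?l \<le> 2" by (simp add: field_simps)
  then have "(1 / ?l) ^ p \<le> 2 ^ p" using l by (intro power_mono) auto
  then have "\<bar>c\<bar> / ?l * (1 / ?l) ^ p \<le> \<bar>c\<bar> / ?l * 2 ^ p"
    using l by (intro mult_left_mono) auto
  moreover have "\<bar>c / ?l ^ Suc p\<bar> = \<bar>c\<bar> / ?l * (1 / ?l) ^ p"
    using l by (simp add: abs_mult power_divide)
  ultimately have "\<bar>c / ?l ^ Suc p\<bar> \<le> 2 ^ p * (\<bar>c\<bar> / ?l)" by (simp add: mult.commute)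
  then have "\<bar>\<alpha>\<bar> * \<bar>c / ?l ^ Suc p\<bar> * \<bar>hcos \<theta> k x\<bar> \<le> B * (2 ^ p * (\<bar>c\<bar> / ?l)) * 1"
    using assms by (intro mult_mono abs_hcos_le_1 mult_nonneg_nonneg) auto
  then show ?thesis by (simp only: real_norm_def abs_mult mult_1_right mult.assoc)
qed

locale hseries_summable =
  fixes C :: "nat \<Rightarrow> real"
  assumes summable_C: "summable (\<lambda>k. \<bar>C k\<bar> / (real k + 1/2))"
begin

lemma summable_hseries:
  assumes "\<And>k. \<bar>a k t\<bar> \<le> B"
  shows "summable (\<lambda>k. a k t * (C k / (real k + 1/2) ^ Suc p) * hcos \<theta> k x)"
  by (rule summable_comparison_test'[OF summable_mult[OF summable_C, of "B * 2 ^ p"]])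
    (rule hseries_term_bound[OF assms])

lemma uniform_limit_hseries:
  assumes "\<And>k t. t \<in> I \<Longrightarrow> \<bar>a k t\<bar> \<le> B"
  shows "uniform_limit (UNIV \<times> I) (\<lambda>n (x, t). \<Sum>k<n. a k t * (C k / (real k + 1/2) ^ Suc p) * hcos \<theta> k x)
    (hseries C (Suc p) \<theta> a) sequentially"
proof -
  have "uniform_limit (UNIV \<times> I)
    (\<lambda>n z. \<Sum>k<n. (case z of (x, t) \<Rightarrow> a k t * (C k / (real k + 1/2) ^ Suc p) * hcos \<theta> k x))
    (\<lambda>z. \<Sum>k. (case z of (x, t) \<Rightarrow> a k t * (C k / (real k + 1/2) ^ Suc p) * hcos \<theta> k x)) sequentially"
    by (rule Weierstrass_m_test[OF _ summable_mult[OF summable_C, of "B * 2 ^ p"]])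
      (auto simp only: mem_Times_iff case_prod_beta' intro!: hseries_term_bound assms)
  then show ?thesis by (simp only: hseries_def case_prod_beta')
qed

lemma continuous_on_hseries:
  assumes "\<And>k t. t \<in> I \<Longrightarrow> \<bar>a k t\<bar> \<le> B" and "\<And>k. continuous_on I (a k)"
  shows "continuous_on (UNIV \<times> I) (hseries C (Suc p) \<theta> a)"
proof (rule uniform_limit_theorem[OF _ uniform_limit_hseries[OF assms(1)]])
  have "continuous_on (UNIV \<times> I) (\<lambda>z. a k (snd z))" for k
    by (rule continuous_on_compose2[OF assms(2)]) (auto intro: continuous_intros)
  then show "\<forall>\<^sub>F n in sequentially. continuous_on (UNIV \<times> I)
      (\<lambda>(x, t). \<Sum>k<n. a k t * (C k / (real k + 1/2) ^ Suc p) * hcos \<theta> k x)"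
    unfolding case_prod_beta' by (intro always_eventually allI continuous_intros)
qed auto

text \<open>Termwise differentiation asks for uniform convergence of the differentiated series. The
  M-test gives it while a positive exponent remains, hence the start at
  \<open>Suc (Suc p)\<close>.\<close>

lemma hseries_has_x_derivative:
  assumes "\<And>k. \<bar>a k t\<bar> \<le> B"
  shows "((\<lambda>x. hseries C (Suc (Suc p)) \<theta> a (x, t)) has_real_derivative
    hseries C (Suc p) (\<theta> - pi/2) a (x, t)) (at x)"
proof -
  let ?f = "\<lambda>k x. a k t * (C k / (real k + 1/2) ^ Suc (Suc p)) * hcos \<theta> k x"
  let ?f' = "\<lambda>k x. a k t * (C k / (real k + 1/2) ^ Suc p) * hcos (\<theta> - pi/2) k x"
  have d: "(?f k has_real_derivative ?f' k x) (at x within UNIV)" for k x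
  proof -
    have "real k + 1/2 \<noteq> 0" using add_nonneg_pos[of "real k" "1/2"] by simp
    then have "a k t * (C k / (real k + 1/2) ^ Suc (Suc p)) * ((real k + 1/2) * hcos (\<theta> - pi/2) k x) = ?f' k x"
      by (simp add: divide_simps)
    then show ?thesis using DERIV_cmult[OF has_real_derivative_hcos] by metis
  qed
  have "uniformly_convergent_on UNIV (\<lambda>n x. \<Sum>k<n. ?f' k x)"
    by (rule Weierstrass_m_test'[OF hseries_term_bound[OF assms] summable_mult[OF summable_C]])
  from has_field_derivative_series'(2)[OF convex_UNIV d this _ summable_hseries[of a t, OF assms], of x]
  show ?thesis by (simp add: hseries_def)
qed

text \<open>The factor \<open>(k + 1/2)\<^sup>2\<close> produced by the time derivative is absorbed
  by two powers of the weight. The half-line \<open>t > 0\<close> is open and convex, and there the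
  exponentials in the amplitudes are bounded uniformly in \<open>k\<close>.\<close>

lemma hseries_has_t_derivative:
  assumes a: "\<And>k t. t > 0 \<Longrightarrow> \<bar>a k t\<bar> \<le> B"
    and b: "\<And>k t. t > 0 \<Longrightarrow> \<bar>b k t\<bar> \<le> B'"
    and d: "\<And>k t. t > 0 \<Longrightarrow> (a k has_real_derivative (real k + 1/2)\<^sup>2 * b k t) (at t)"
    and t: "t > 0"
  shows "((\<lambda>t. hseries C (Suc (Suc (Suc p))) \<theta> a (x, t)) has_real_derivative
    hseries C (Suc p) \<theta> b (x, t)) (at t)"
proof -
  let ?f = "\<lambda>k t. a k t * (C k / (real k + 1/2) ^ Suc (Suc (Suc p))) * hcos \<theta> k x"
  let ?f' = "\<lambda>k t. b k t * (C k / (real k + 1/2) ^ Suc p) * hcos \<theta> k x"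
  have d': "(?f k has_real_derivative ?f' k t) (at t within {0<..})" if "t \<in> {0<..}" for k t
  proof -
    have "real k + 1/2 \<noteq> 0" using add_nonneg_pos[of "real k" "1/2"] by simp
    then have "(real k + 1/2)\<^sup>2 * b k t * (C k / (real k + 1/2) ^ Suc (Suc (Suc p))) * hcos \<theta> k x = ?f' k t"
      by (simp add: divide_simps power2_eq_square)
    moreover have "(?f k has_real_derivative
        (real k + 1/2)\<^sup>2 * b k t * (C k / (real k + 1/2) ^ Suc (Suc (Suc p))) * hcos \<theta> k x) (at t)"
      by (intro DERIV_cmult_right d) (use that in auto)
    ultimately show ?thesis by (metis has_field_derivative_at_within)
  qed
  have "uniformly_convergent_on {0<..} (\<lambda>n t. \<Sum>k<n. ?f' k t)"
    by (rule Weierstrass_m_test'[OF hseries_term_bound[OF b] summable_mult[OF summable_C]]) auto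
  from has_field_derivative_series'(2)[OF convex_real_interval(3) d' this _ summable_hseries[of a t, OF a[OF t]], of t] t
  show ?thesis by (simp add: hseries_def interior_open)
qed

lemma hseries_neg_x:
  assumes a: "\<And>k. \<bar>a k t\<bar> \<le> B" and refl: "\<And>k x. hcos \<theta> k (-x) = \<sigma> * hcos \<theta> k x"
  shows "hseries C (Suc p) \<theta> a (- x, t) = \<sigma> * hseries C (Suc p) \<theta> a (x, t)"
proof -
  have "hseries C (Suc p) \<theta> a (- x, t) = (\<Sum>k. \<sigma> * (a k t * (C k / (real k + 1/2) ^ Suc p) * hcos \<theta> k x))"
    by (simp only: hseries_def case_prod_conv refl mult.left_commute[of _ \<sigma>])
  also have "\<dots> = \<sigma> * hseries C (Suc p) \<theta> a (x, t)"
    unfolding hseries_def case_prod_conv by (rule suminf_mult[OF summable_hseries]) (rule a)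
  finally show ?thesis .
qed

lemma hseries_antiperiodic:
  assumes a: "\<And>k. \<bar>a k t\<bar> \<le> B"
  shows "hseries C (Suc p) \<theta> a (- pi, t) = - hseries C (Suc p) \<theta> a (pi, t)"
  unfolding hseries_def case_prod_conv hcos_antiperiodic mult_minus_right
  by (rule suminf_minus[OF summable_hseries]) (rule a)

text \<open>The phase has the form that two x-derivatives produce; the shift by pi in total brings
  the second derivative back to the original family.\<close>

lemma hseries_phase_minus_pi:
  assumes a: "\<And>k. \<bar>a k t\<bar> \<le> B"
  shows "hseries C (Suc p) (\<theta> - pi/2 - pi/2) a (x, t) = - hseries C (Suc p) \<theta> a (x, t)"
proof -
  have "hcos (\<theta> - pi/2 - pi/2) k x = - hcos \<theta> k x" for k
    using hcos_add_pi[of "\<theta> - pi" k x] by (simp add: diff_diff_eq)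
  then show ?thesis
    unfolding hseries_def case_prod_conv mult_minus_right
    by (simp only: mult_minus_right) (rule suminf_minus[OF summable_hseries], rule a)
qed

text \<open>Sums the mode equation \<open>amp_sum\<close> over \<open>k\<close>. The separate time
  \<open>s\<close> is there because the right side of that equation is taken at time 0.\<close>

lemma hseries_linear_combination:
  assumes a: "\<And>k. \<bar>a k t\<bar> \<le> B" and b: "\<And>k. \<bar>b k t\<bar> \<le> B'"
    and c: "\<And>k. a k t + \<mu> * b k t = c k s"
  shows "hseries C (Suc p) \<theta> a (x, t) + \<mu> * hseries C (Suc p) \<theta> b (x, t) = hseries C (Suc p) \<theta> c (x, s)"
proof -
  note sa = summable_hseries[of a t, OF a, of p \<theta> x] and sb = summable_hseries[of b t, OF b, of p \<theta> x]
  have "c k s * (C k / (real k + 1/2) ^ Suc p) * hcos \<theta> k x = a k t * (C k / (real k + 1/2) ^ Suc p) * hcos \<theta> k x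
      + \<mu> * (b k t * (C k / (real k + 1/2) ^ Suc p) * hcos \<theta> k x)" for k
    unfolding c[symmetric] by (simp only: distrib_right mult.assoc)
  then show ?thesis
    unfolding hseries_def case_prod_conv
    by (simp only: suminf_add[OF sa summable_mult[OF sb], symmetric] suminf_mult[OF sb])
qed

text \<open>Uniform convergence permits termwise integration, and by orthogonality the integrals of
  the partial sums are constant once \<open>n > j\<close>.\<close>

lemma integral_hseries_hcos:
  assumes a: "\<And>k. \<bar>a k t\<bar> \<le> B"
  shows "integral {-pi..pi} (\<lambda>x. hseries C (Suc p) \<theta> a (x, t) * hcos \<theta>' j x) =
    pi * cos (\<theta> - \<theta>') * (a j t * (C j / (real j + 1/2) ^ Suc p))"
proof -
  define w where "w k = a k t * (C k / (real k + 1/2) ^ Suc p)" for k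
  have "uniform_limit {-pi..pi} (\<lambda>n x. \<Sum>k<n. w k * hcos \<theta> k x * hcos \<theta>' j x)
      (\<lambda>x. \<Sum>k. w k * hcos \<theta> k x * hcos \<theta>' j x) sequentially"
  proof (rule Weierstrass_m_test[OF _ summable_mult[OF summable_C]])
    fix k x
    have "norm (w k * hcos \<theta> k x * hcos \<theta>' j x) \<le> norm (w k * hcos \<theta> k x)"
      using mult_left_mono[OF abs_hcos_le_1[of \<theta>' j x], of "\<bar>w k * hcos \<theta> k x\<bar>"] by (simp add: abs_mult)
    also have "\<dots> \<le> B * 2 ^ p * (\<bar>C k\<bar> / (real k + 1/2))"
      unfolding w_def by (rule hseries_term_bound[OF a])
    finally show "norm (w k * hcos \<theta> k x * hcos \<theta>' j x) \<le> B * 2 ^ p * (\<bar>C k\<bar> / (real k + 1/2))" .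
  qed
  moreover have "(\<Sum>k. w k * hcos \<theta> k x * hcos \<theta>' j x) = hseries C (Suc p) \<theta> a (x, t) * hcos \<theta>' j x" for x
    unfolding hseries_def case_prod_conv w_def
    by (rule suminf_mult2[OF summable_hseries, symmetric]) (rule a)
  ultimately have ul: "uniform_limit {-pi..pi} (\<lambda>n x. \<Sum>k<n. w k * hcos \<theta> k x * hcos \<theta>' j x)
      (\<lambda>x. hseries C (Suc p) \<theta> a (x, t) * hcos \<theta>' j x) sequentially" by (simp only:)
  obtain I J where I: "\<And>n. ((\<lambda>x. \<Sum>k<n. w k * hcos \<theta> k x * hcos \<theta>' j x) has_integral I n) {-pi..pi}"
    and J: "((\<lambda>x. hseries C (Suc p) \<theta> a (x, t) * hcos \<theta>' j x) has_integral J) {-pi..pi}"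
    and lim: "I \<longlonglongrightarrow> J"
    by (rule uniform_limit_integral[OF ul]) (auto intro!: continuous_intros)
  have "I n = pi * cos (\<theta> - \<theta>') * w j" if "n > j" for n
  proof -
    have "I n = integral {-pi..pi} (\<lambda>x. \<Sum>k<n. w k * (hcos \<theta> k x * hcos \<theta>' j x))"
      using integral_unique[OF I[of n]] by (simp only: mult.assoc)
    also have "\<dots> = (\<Sum>k<n. integral {-pi..pi} (\<lambda>x. w k * (hcos \<theta> k x * hcos \<theta>' j x)))"
      by (rule integral_sum) (auto intro!: integrable_continuous_real continuous_intros)
    also have "\<dots> = (\<Sum>k<n. if k = j then w j * (pi * cos (\<theta> - \<theta>')) else 0)"
      by (intro sum.cong refl) (simp add: hcos_orthogonal)
    finally show ?thesis using that by (simp add: mult_ac)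
  qed
  then have "I \<longlonglongrightarrow> pi * cos (\<theta> - \<theta>') * w j"
    by (intro tendsto_eventually eventually_sequentiallyI[of "Suc j"]) auto
  then have "J = pi * cos (\<theta> - \<theta>') * w j" using lim LIMSEQ_unique by blast
  then show ?thesis using integral_unique[OF J] by (simp add: w_def)
qed

end

text \<open>The solution of \<open>y' = (k + 1/2)\<^sup>2 * (const - \<mu> * y)\<close> with value 0
  at \<open>t = 0\<close> and 1 at \<open>t = T\<close>: it carries each mode from its \<phi>
  coefficient to its \<psi> coefficient.\<close>

definition amp :: "real \<Rightarrow> real \<Rightarrow> nat \<Rightarrow> real \<Rightarrow> real" where
  "amp \<mu> T k t = (1 - exp (- \<mu> * (real k + 1/2)\<^sup>2 * t)) / (1 - exp (- \<mu> * (real k + 1/2)\<^sup>2 * T))"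

text \<open>\<open>amp'\<close> is the time derivative of \<open>amp\<close> divided by \<open>(k + 1/2)\<^sup>2\<close>.\<close>
definition amp' :: "real \<Rightarrow> real \<Rightarrow> nat \<Rightarrow> real \<Rightarrow> real" where
  "amp' \<mu> T k t = \<mu> * exp (- \<mu> * (real k + 1/2)\<^sup>2 * t) / (1 - exp (- \<mu> * (real k + 1/2)\<^sup>2 * T))"

context
  fixes \<mu> T :: real
  assumes \<mu>: "\<mu> > 0" and T: "T > 0"
begin

text \<open>Uniformity in \<open>k\<close> comes from the worst case \<open>k = 0\<close>, where
  \<open>(k + 1/2)\<^sup>2 = 1/4\<close>.\<close>

lemma amp_denominator_bound: "1 - exp (- \<mu> * (real k + 1/2)\<^sup>2 * T) \<ge> 1 - exp (- (\<mu> * T / 4))"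
  and amp_denominator_pos: "1 - exp (- (\<mu> * T / 4)) > 0"
proof -
  have "(1/2)\<^sup>2 \<le> (real k + 1/2)\<^sup>2" by (rule power_mono) auto
  then have "(\<mu> * T) * (1/4) \<le> (\<mu> * T) * (real k + 1/2)\<^sup>2"
    using \<mu> T by (intro mult_left_mono) (auto simp: power2_eq_square)
  then show "1 - exp (- \<mu> * (real k + 1/2)\<^sup>2 * T) \<ge> 1 - exp (- (\<mu> * T / 4))"
    by (simp add: mult_ac)
  show "1 - exp (- (\<mu> * T / 4)) > 0" using \<mu> T by simp
qed

lemma amp_denominator_neq_0: "1 - exp (- \<mu> * (real k + 1/2)\<^sup>2 * T) \<noteq> 0"
  using amp_denominator_bound[of k] amp_denominator_pos by linarith

lemma amp_bounded: "t \<ge> 0 \<Longrightarrow> \<bar>amp \<mu> T k t\<bar> \<le> 1 / (1 - exp (- (\<mu> * T / 4)))"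
  and amp'_bounded: "t \<ge> 0 \<Longrightarrow> \<bar>amp' \<mu> T k t\<bar> \<le> \<mu> / (1 - exp (- (\<mu> * T / 4)))"
proof -
  assume t: "t \<ge> 0"
  have e: "exp (- \<mu> * (real k + 1/2)\<^sup>2 * t) \<le> 1" using \<mu> t by simp
  note d = amp_denominator_bound[of k] amp_denominator_pos
  then have d': "0 < 1 - exp (- \<mu> * (real k + 1/2)\<^sup>2 * T)" by linarith
  have "amp \<mu> T k t \<ge> 0" unfolding amp_def using e d' by (intro divide_nonneg_nonneg) linarith+
  moreover have "amp \<mu> T k t \<le> 1 / (1 - exp (- (\<mu> * T / 4)))"
    unfolding amp_def by (rule frac_le) (use d e in auto)
  ultimately show "\<bar>amp \<mu> T k t\<bar> \<le> 1 / (1 - exp (- (\<mu> * T / 4)))" by simp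
  have "amp' \<mu> T k t \<ge> 0" unfolding amp'_def using e d' \<mu> by (intro divide_nonneg_nonneg mult_nonneg_nonneg) auto
  moreover have "amp' \<mu> T k t \<le> \<mu> / (1 - exp (- (\<mu> * T / 4)))"
    unfolding amp'_def using mult_left_mono[OF e, of \<mu>] \<mu> d by (intro frac_le) auto
  ultimately show "\<bar>amp' \<mu> T k t\<bar> \<le> \<mu> / (1 - exp (- (\<mu> * T / 4)))" by simp
qed

lemma amp_has_derivative: "(amp \<mu> T k has_real_derivative (real k + 1/2)\<^sup>2 * amp' \<mu> T k t) (at t)"
  unfolding amp_def[abs_def] amp'_def using amp_denominator_neq_0[of k]
  by (auto intro!: derivative_eq_intros simp: mult_ac)

lemma amp_continuous: "continuous_on S (amp \<mu> T k)" "continuous_on S (amp' \<mu> T k)"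
  unfolding amp_def[abs_def] amp'_def[abs_def] using amp_denominator_neq_0[of k]
  by (auto intro!: continuous_intros)

lemma amp_0: "amp \<mu> T k 0 = 0" and amp_T: "amp \<mu> T k T = 1"
  using amp_denominator_neq_0[of k] by (simp_all add: amp_def)

text \<open>The mode equation divided by \<open>(k + 1/2)\<^sup>2\<close>. Its constant right side
  is the source amplitude appearing in \<open>sol_f\<close>.\<close>

lemma amp_sum: "amp' \<mu> T k t + \<mu> * amp \<mu> T k t = amp' \<mu> T k 0"
  by (simp add: amp_def amp'_def right_diff_distrib flip: add_divide_distrib)

end

subsection \<open>Uniqueness\<close>

text \<open>Supplies the limit \<open>r \<rightarrow> pi\<close> in
  \<open>regular_solution_coefficient\<close>; the integral is a difference of two values of one
  primitive.\<close>

lemma continuous_on_symmetric_integral: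
  fixes h :: "real \<Rightarrow> real"
  assumes h: "continuous_on {-R..R} h"
  shows "continuous_on {0..R} (\<lambda>r. integral {-r..r} h)"
proof -
  define H where "H x = integral {-R..x} h" for x
  have i: "h integrable_on {-R..R}" using h by (rule integrable_continuous_real)
  have H: "continuous_on {-R..R} H"
    unfolding H_def by (rule indefinite_integral_continuous_1[OF i])
  have "continuous_on {0..R} (\<lambda>r. H r - H (-r))"
    by (intro continuous_intros continuous_on_compose2[OF H]) auto
  moreover have "H r - H (-r) = integral {-r..r} h" if "r \<in> {0..R}" for r
  proof -
    have "h integrable_on {-R..r}"
      by (rule integrable_on_subinterval[OF i]) (use that in auto)
    from Henstock_Kurzweil_Integration.integral_combine[OF _ _ this, of "-r"] that
    show ?thesis by (simp add: H_def)
  qed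
  ultimately show ?thesis by (rule continuous_on_eq)
qed

lemma continuous_on_strip_slice:
  assumes "continuous_on (A \<times> B) v" "t \<in> B"
  shows "continuous_on A (\<lambda>x. v (x, t))"
  by (rule continuous_on_compose2[OF assms(1)]) (use assms(2) in \<open>auto intro!: continuous_intros\<close>)

text \<open>For \<open>r < pi\<close> anti-periodicity says nothing about the ends of the interval,
  so all boundary terms are kept.\<close>

lemma integral_second_derivative_hcos:
  assumes "r \<ge> 0"
    and v: "\<And>x. x \<in> {-r..r} \<Longrightarrow> (v has_real_derivative v1 x) (at x within {-r..r})"
    and v1: "\<And>x. x \<in> {-r..r} \<Longrightarrow> (v1 has_real_derivative v2 x) (at x within {-r..r})"
    and v2: "continuous_on {-r..r} v2"
  shows "integral {-r..r} (\<lambda>x. v2 x * hcos \<theta> k x) =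
    v1 r * hcos \<theta> k r - v1 (-r) * hcos \<theta> k (-r)
    - (real k + 1/2) * (v r * hcos (\<theta> - pi/2) k r - v (-r) * hcos (\<theta> - pi/2) k (-r))
    - (real k + 1/2)\<^sup>2 * integral {-r..r} (\<lambda>x. v x * hcos \<theta> k x)"
proof -
  let ?l = "real k + 1/2"
  have c1: "continuous_on {-r..r} v1" using v1 DERIV_continuous_on by blast
  have "integral {-r..r} (\<lambda>x. v2 x * hcos \<theta> k x) = v1 r * hcos \<theta> k r - v1 (-r) * hcos \<theta> k (-r)
     - integral {-r..r} (\<lambda>x. v1 x * (?l * hcos (\<theta> - pi/2) k x))"
    by (rule integral_by_parts_real[OF _ v1 has_real_derivative_hcos v2])
      (use \<open>r \<ge> 0\<close> in \<open>auto intro!: continuous_intros\<close>)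
  also have "integral {-r..r} (\<lambda>x. v1 x * (?l * hcos (\<theta> - pi/2) k x)) =
     ?l * integral {-r..r} (\<lambda>x. v1 x * hcos (\<theta> - pi/2) k x)"
    by (simp only: mult.left_commute[of _ ?l] integral_mult_right)
  also have "integral {-r..r} (\<lambda>x. v1 x * hcos (\<theta> - pi/2) k x) =
     v r * hcos (\<theta> - pi/2) k r - v (-r) * hcos (\<theta> - pi/2) k (-r)
     - integral {-r..r} (\<lambda>x. v x * (?l * hcos (\<theta> - pi/2 - pi/2) k x))"
    by (rule integral_by_parts_real[OF _ v has_real_derivative_hcos c1])
      (use \<open>r \<ge> 0\<close> in \<open>auto intro!: continuous_intros\<close>)
  also have "integral {-r..r} (\<lambda>x. v x * (?l * hcos (\<theta> - pi/2 - pi/2) k x)) =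
     - ?l * integral {-r..r} (\<lambda>x. v x * hcos \<theta> k x)"
  proof -
    have "hcos (\<theta> - pi/2 - pi/2) k x = - hcos \<theta> k x" for x
      using hcos_add_pi[of "\<theta> - pi" k x] by (simp add: diff_diff_eq)
    then have "v x * (?l * hcos (\<theta> - pi/2 - pi/2) k x) = - ?l * (v x * hcos \<theta> k x)" for x
      by (simp add: algebra_simps)
    then show ?thesis by (simp only: integral_mult_right)
  qed
  finally have "integral {-r..r} (\<lambda>x. v2 x * hcos \<theta> k x) = v1 r * hcos \<theta> k r - v1 (-r) * hcos \<theta> k (-r)
     - ?l * (v r * hcos (\<theta> - pi/2) k r - v (-r) * hcos (\<theta> - pi/2) k (-r)
        - - ?l * integral {-r..r} (\<lambda>x. v x * hcos \<theta> k x))" .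
  moreover have "A - l * (X - - l * Y) = A - l * X - l\<^sup>2 * Y" for A X Y l :: real
    by (simp add: power2_eq_square algebra_simps)
  ultimately show ?thesis by (simp only:)
qed

text \<open>The derivatives \<open>u\<^sub>t\<close> and \<open>u\<^sub>x\<^sub>x\<close> may blow up at the lateral boundary, so the equation for the
  Fourier coefficient is derived on \<open>[-r, r]\<close>, with an error that vanishes as \<open>r \<rightarrow> \<pi>\<close> by the
  boundary conditions.\<close>
lemma regular_solution_coefficient:
  assumes sol: "regular_solution T \<epsilon> \<phi> \<psi> u f"
    and refl: "\<And>x. hcos \<theta> k (-x) = \<sigma> * hcos \<theta> k x"
    and pos: "1 - \<sigma> * \<epsilon> > 0"
    and t: "t \<in> {0..T}"
  defines "a \<equiv> (1 - \<sigma> * \<epsilon>) * (real k + 1/2)\<^sup>2"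
    and "c \<equiv> (\<lambda>t. integral {-pi..pi} (\<lambda>x. u (x, t) * hcos \<theta> k x))"
    and "F \<equiv> integral {-pi..pi} (\<lambda>x. f x * hcos \<theta> k x)"
  shows "exp (a * t) * (c t - F / a) = c 0 - F / a"
proof (cases "t = 0")
  case False
  let ?l = "real k + 1/2"
  define \<mu> where "\<mu> = 1 - \<sigma> * \<epsilon>"
  have \<mu>: "\<mu> > 0" using pos by (simp add: \<mu>_def)
  have l: "?l > 0" by (simp add: add_nonneg_pos)
  have a: "a > 0" unfolding a_def using pos l by simp
  have t0: "0 < t" "t \<le> T" using t False by auto
  obtain ux uxx ut where
    u: "continuous_on ({-pi..pi} \<times> {0..T}) u"
    and dux: "\<forall>x\<in>{-pi..pi}. \<forall>t\<in>{0..T}.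
        ((\<lambda>y. u (y, t)) has_real_derivative ux (x, t)) (at x within {-pi..pi})"
    and ux: "continuous_on ({-pi..pi} \<times> {0..T}) ux"
    and duxx: "\<forall>x\<in>{-pi<..<pi}. \<forall>t\<in>{0<..<T}.
        ((\<lambda>y. ux (y, t)) has_real_derivative uxx (x, t)) (at x) \<and>
        ((\<lambda>s. u (x, s)) has_real_derivative ut (x, t)) (at t)"
    and uxx: "continuous_on ({-pi<..<pi} \<times> {0<..<T}) uxx"
    and ut: "continuous_on ({-pi<..<pi} \<times> {0<..<T}) ut"
    and f: "continuous_on {-pi..pi} f"
    and eq: "\<forall>x\<in>{-pi<..<pi}. \<forall>t\<in>{0<..<T}. ut (x, t) - uxx (x, t) + \<epsilon> * uxx (-x, t) = f x"
    and anti: "\<forall>t\<in>{0..T}. u (-pi, t) = - u (pi, t) \<and> ux (-pi, t) = - ux (pi, t)"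
    using sol unfolding regular_solution_def by (elim exE conjE) (rule that; assumption)
  note dux = dux[rule_format] and eq = eq[rule_format]
    and dut = conjunct2[OF duxx[rule_format]] and duxx = conjunct1[OF duxx[rule_format]]
    and anti = conjunct1[OF anti[rule_format]] conjunct2[OF anti[rule_format]]
  define cr where "cr r t = integral {-r..r} (\<lambda>x. u (x, t) * hcos \<theta> k x)" for r t
  define Fr where "Fr r = integral {-r..r} (\<lambda>x. f x * hcos \<theta> k x)" for r
  \<comment> \<open>\<open>B\<close> gathers the boundary terms at \<open>-r\<close> and
    \<open>r\<close>. The integrating factor in \<open>G\<close> makes its time derivative a
    multiple of \<open>B\<close> alone.\<close>
  define B where "B = (\<lambda>(r, t). ux (r, t) * hcos \<theta> k r - ux (-r, t) * hcos \<theta> k (-r)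
    - ?l * (u (r, t) * hcos (\<theta> - pi/2) k r - u (-r, t) * hcos (\<theta> - pi/2) k (-r)))"
  define G where "G r s = exp (a * s) * (cr r s - Fr r / a)" for r s
  have cr_deriv: "(cr r has_real_derivative Fr r + \<mu> * B (r, s) - a * cr r s) (at s)"
    if r: "r \<in> {0<..<pi}" and s: "s \<in> {0<..<T}" for r s
  proof -
    have sub: "{-r..r} \<subseteq> {-pi<..<pi}" using r by auto
    have ut': "continuous_on ({0<..<T} \<times> cbox (-r) r) (\<lambda>(s, x). ut (x, s) * hcos \<theta> k x)"
      unfolding case_prod_beta'
      by (intro continuous_intros continuous_on_compose2[OF ut]) (use sub in auto)
    have us: "continuous_on {-r..r} (\<lambda>x. u (x, s))" if "s \<in> {0<..<T}" for s
      by (rule continuous_on_subset[OF continuous_on_strip_slice[OF u]]) (use that sub r in auto)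
    have uxxs: "continuous_on {-r..r} (\<lambda>x. uxx (x, s))"
      by (rule continuous_on_subset[OF continuous_on_strip_slice[OF uxx s] sub])
    have uxxs': "continuous_on {-r..r} (\<lambda>x. uxx (-x, s))"
      by (rule continuous_on_compose2[OF uxxs]) (auto intro: continuous_intros)
    have fs: "continuous_on {-r..r} f" by (rule continuous_on_subset[OF f order.trans[OF sub]]) auto
    have "((\<lambda>s. integral (cbox (-r) r) (\<lambda>x. u (x, s) * hcos \<theta> k x)) has_real_derivative
        integral (cbox (-r) r) (\<lambda>x. ut (x, s) * hcos \<theta> k x)) (at s within {0<..<T})"
    proof (rule leibniz_rule_field_derivative[OF _ _ ut'])
      show "((\<lambda>s. u (x, s) * hcos \<theta> k x) has_real_derivative ut (x, s) * hcos \<theta> k x) (at s within {0<..<T})"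
        if "s \<in> {0<..<T}" "x \<in> cbox (-r) r" for s x
        by (intro DERIV_cmult_right has_field_derivative_at_within[OF dut]) (use that sub in auto)
      show "(\<lambda>x. u (x, s) * hcos \<theta> k x) integrable_on cbox (-r) r" if "s \<in> {0<..<T}" for s
        by (intro integrable_continuous) (use us[OF that] in \<open>auto intro!: continuous_intros\<close>)
    qed (use s in auto)
    then have d: "(cr r has_real_derivative integral {-r..r} (\<lambda>x. ut (x, s) * hcos \<theta> k x)) (at s)"
      unfolding at_within_open[OF s open_greaterThanLessThan] cr_def[abs_def] cbox_interval .
    have "integral {-r..r} (\<lambda>x. ut (x, s) * hcos \<theta> k x) =
        integral {-r..r} (\<lambda>x. f x * hcos \<theta> k x + uxx (x, s) * hcos \<theta> k x - \<epsilon> * (uxx (-x, s) * hcos \<theta> k x))"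
    proof (rule integral_cong)
      fix x assume "x \<in> {-r..r}"
      then have "x \<in> {-pi<..<pi}" using sub by blast
      from eq[OF this s] have "ut (x, s) = f x + uxx (x, s) - \<epsilon> * uxx (-x, s)" by linarith
      then show "ut (x, s) * hcos \<theta> k x =
          f x * hcos \<theta> k x + uxx (x, s) * hcos \<theta> k x - \<epsilon> * (uxx (-x, s) * hcos \<theta> k x)"
        by (simp only:) (simp add: algebra_simps)
    qed
    also have "\<dots> = Fr r + integral {-r..r} (\<lambda>x. uxx (x, s) * hcos \<theta> k x)
        - \<epsilon> * integral {-r..r} (\<lambda>x. uxx (-x, s) * hcos \<theta> k x)"
      unfolding Fr_def
      by (subst integral_diff integral_add,
          (intro integrable_continuous_real continuous_intros fs uxxs uxxs')+)+
        (simp only: integral_mult_right)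
    \<comment> \<open>Substituting \<open>-x\<close> moves the reflection onto \<open>hcos\<close>,
      where it is the factor \<sigma>; the two second-derivative terms then merge with coefficient
      \<mu>.\<close>
    also have "integral {-r..r} (\<lambda>x. uxx (-x, s) * hcos \<theta> k x) =
        integral {-r..r} (\<lambda>x. uxx (x, s) * hcos \<theta> k (-x))"
      using Henstock_Kurzweil_Integration.integral_reflect_real[of r "-r" "\<lambda>x. uxx (x, s) * hcos \<theta> k (-x)"]
      by simp
    also have "\<dots> = \<sigma> * integral {-r..r} (\<lambda>x. uxx (x, s) * hcos \<theta> k x)"
      by (simp only: refl mult.left_commute[of _ \<sigma>] integral_mult_right)
    also have "integral {-r..r} (\<lambda>x. uxx (x, s) * hcos \<theta> k x) = B (r, s) - ?l\<^sup>2 * cr r s"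
      unfolding B_def cr_def case_prod_conv
    proof (rule integral_second_derivative_hcos)
      show "((\<lambda>x. u (x, s)) has_real_derivative ux (x, s)) (at x within {-r..r})" if "x \<in> {-r..r}" for x
        by (rule DERIV_subset[OF dux]) (use that r s in auto)
      show "((\<lambda>x. ux (x, s)) has_real_derivative uxx (x, s)) (at x within {-r..r})" if "x \<in> {-r..r}" for x
        by (rule has_field_derivative_at_within[OF duxx]) (use that sub s in auto)
    qed (use r uxxs in auto)
    finally have "integral {-r..r} (\<lambda>x. ut (x, s) * hcos \<theta> k x) = Fr r + \<mu> * B (r, s) - a * cr r s"
      by (simp add: a_def \<mu>_def algebra_simps)
    then show ?thesis using d by simp
  qed
  have G_deriv: "(G r has_real_derivative exp (a * s) * \<mu> * B (r, s)) (at s)"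
    if "r \<in> {0<..<pi}" "s \<in> {0<..<T}" for r s
  proof -
    have "((\<lambda>s. exp (a * s) * (cr r s - Fr r / a)) has_real_derivative
       (a * exp (a * s)) * (cr r s - Fr r / a) + (Fr r + \<mu> * B (r, s) - a * cr r s - 0) * exp (a * s)) (at s)"
      by (rule DERIV_mult[OF _ DERIV_diff[OF cr_deriv[OF that] DERIV_const]])
        (auto intro!: derivative_eq_intros)
    also have "(a * exp (a * s)) * (cr r s - Fr r / a) + (Fr r + \<mu> * B (r, s) - a * cr r s - 0) * exp (a * s) =
       exp (a * s) * \<mu> * B (r, s)"
      using a by (simp add: field_simps)
    finally show ?thesis by (simp add: G_def[abs_def])
  qed
  have G_cont: "continuous_on {0..T} (G r)" if r: "r \<in> {0<..<pi}" for r
  proof -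
    have "continuous_on {0..T} (\<lambda>s. integral (cbox (-r) r) (\<lambda>x. u (x, s) * hcos \<theta> k x))"
      by (rule integral_continuous_on_param, unfold case_prod_beta')
        (intro continuous_intros continuous_on_compose2[OF u], use r in auto)
    then have "continuous_on {0..T} (cr r)" by (simp add: cr_def[abs_def])
    then show ?thesis unfolding G_def by (intro continuous_intros)
  qed
  have B_cont: "continuous_on ({0..pi} \<times> {0..T}) B"
    unfolding B_def case_prod_beta'
    by (intro continuous_intros continuous_on_compose2[OF u] continuous_on_compose2[OF ux]) auto
  have B_pi: "B (pi, s) = 0" if "s \<in> {0..T}" for s
    by (simp add: B_def anti[OF that] hcos_antiperiodic)
  \<comment> \<open>\<open>K\<close> dominates the factor of \<open>B\<close> in the mean value
    theorem, uniformly in \<open>r\<close> and in the intermediate time.\<close>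
  define K where "K = exp (a * T) * \<mu> * T + 1"
  have K: "K > 0" unfolding K_def using \<mu> t0 by (simp add: add_nonneg_pos)
  have bound: "\<bar>G r t - G r 0\<bar> \<le> K * \<eta>"
    if r: "r \<in> {0<..<pi}" and B: "\<And>s. s \<in> {0..T} \<Longrightarrow> \<bar>B (r, s)\<bar> \<le> \<eta>" for r \<eta>
  proof -
    have \<eta>: "\<eta> \<ge> 0" using B[of 0] t0 by force
    obtain s where s: "0 < s" "s < t" and eq: "G r t - G r 0 = (exp (a * s) * \<mu> * B (r, s)) * (t - 0)"
    proof (rule mvt[OF \<open>0 < t\<close>, of "G r" "\<lambda>s. (*) (exp (a * s) * \<mu> * B (r, s))"])
      show "continuous_on {0..t} (G r)"
        by (rule continuous_on_subset[OF G_cont[OF r]]) (use t0 in auto)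
      show "(G r has_derivative (*) (exp (a * s) * \<mu> * B (r, s))) (at s)" if "0 < s" "s < t" for s
        using G_deriv[OF r, of s] that t0 by (simp add: has_field_derivative_def)
    qed blast
    have "\<bar>G r t - G r 0\<bar> = exp (a * s) * \<mu> * \<bar>B (r, s)\<bar> * t"
      using \<mu> t0 by (simp add: eq abs_mult)
    also have "\<dots> \<le> exp (a * T) * \<mu> * \<eta> * T"
      using a \<mu> s t0 \<eta> by (intro mult_mono B) auto
    also have "\<dots> \<le> K * \<eta>" using \<eta> by (simp add: K_def algebra_simps)
    finally show ?thesis .
  qed
  have "((\<lambda>r. G r t - G r 0) \<longlongrightarrow> 0) (at_left pi)"
  proof (rule tendstoI)
    fix e :: real assume e: "e > 0"
    \<comment> \<open>Since \<open>B\<close> vanishes at \<open>r = pi\<close>, uniform continuity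
      makes it small near pi for all times simultaneously.\<close>
    have "uniformly_continuous_on ({0..pi} \<times> {0..T}) B"
      by (intro compact_uniformly_continuous B_cont compact_Times compact_Icc)
    then obtain d where d: "d > 0" and
      dB: "\<And>p q. p \<in> {0..pi} \<times> {0..T} \<Longrightarrow> q \<in> {0..pi} \<times> {0..T} \<Longrightarrow> dist q p < d \<Longrightarrow> dist (B q) (B p) < e / (2 * K)"
      unfolding uniformly_continuous_on_def using e K by (metis divide_pos_pos mult_pos_pos zero_less_numeral)
    have "\<bar>G r t - G r 0\<bar> < e" if r: "r \<in> {max 0 (pi - d)<..<pi}" for r
    proof -
      have "\<bar>B (r, s)\<bar> \<le> e / (2 * K)" if s: "s \<in> {0..T}" for s
        using dB[of "(pi, s)" "(r, s)"] r s d by (simp add: B_pi dist_Pair_Pair dist_real_def)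
      then have "\<bar>G r t - G r 0\<bar> \<le> K * (e / (2 * K))" by (intro bound) (use r in auto)
      also have "\<dots> < e" using K e by simp
      finally show ?thesis .
    qed
    then show "\<forall>\<^sub>F r in at_left pi. dist (G r t - G r 0) 0 < e"
      using eventually_at_leftI[of "max 0 (pi - d)" pi] d by simp
  qed
  \<comment> \<open>A second evaluation of the same limit, by continuity in \<open>r\<close>;
    equating the two gives the identity at \<open>r = pi\<close>.\<close>
  moreover have "((\<lambda>r. G r t - G r 0) \<longlongrightarrow> G pi t - G pi 0) (at_left pi)"
  proof (rule continuous_on_Icc_at_leftD)
    have "continuous_on {0..pi} (\<lambda>r. cr r s)" if "s \<in> {0..T}" for s
      unfolding cr_def
      by (intro continuous_on_symmetric_integral continuous_intros continuous_on_strip_slice[OF u that])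
    moreover have "continuous_on {0..pi} Fr"
      unfolding Fr_def by (intro continuous_on_symmetric_integral continuous_intros f)
    ultimately show "continuous_on {0..pi} (\<lambda>r. G r t - G r 0)"
      unfolding G_def using t0 a by (intro continuous_intros) auto
  qed simp
  ultimately have "G pi t - G pi 0 = 0"
    using tendsto_unique[OF trivial_limit_at_left_real] by blast
  then show ?thesis by (simp add: G_def cr_def c_def Fr_def F_def)
qed simp

lemma regular_solution_diff:
  assumes "regular_solution T \<epsilon> \<phi> \<psi> u f" and "regular_solution T \<epsilon> \<phi> \<psi> v g"
  shows "regular_solution T \<epsilon> (\<lambda>_. 0) (\<lambda>_. 0) (\<lambda>z. u z - v z) (\<lambda>x. f x - g x)"
proof -
  from assms(1) obtain ux uxx ut where 1:
    "continuous_on ({-pi..pi} \<times> {0..T}) u"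
    "\<forall>x\<in>{-pi..pi}. \<forall>t\<in>{0..T}. ((\<lambda>y. u (y, t)) has_real_derivative ux (x, t)) (at x within {-pi..pi})"
    "continuous_on ({-pi..pi} \<times> {0..T}) ux"
    "\<forall>x\<in>{-pi<..<pi}. \<forall>t\<in>{0<..<T}. ((\<lambda>y. ux (y, t)) has_real_derivative uxx (x, t)) (at x) \<and>
       ((\<lambda>s. u (x, s)) has_real_derivative ut (x, t)) (at t)"
    "continuous_on ({-pi<..<pi} \<times> {0<..<T}) uxx" "continuous_on ({-pi<..<pi} \<times> {0<..<T}) ut"
    "continuous_on {-pi..pi} f"
    "\<forall>x\<in>{-pi<..<pi}. \<forall>t\<in>{0<..<T}. ut (x, t) - uxx (x, t) + \<epsilon> * uxx (-x, t) = f x"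
    "\<forall>x\<in>{-pi..pi}. u (x, 0) = \<phi> x \<and> u (x, T) = \<psi> x"
    "\<forall>t\<in>{0..T}. u (-pi, t) = - u (pi, t) \<and> ux (-pi, t) = - ux (pi, t)"
    unfolding regular_solution_def by blast
  from assms(2) obtain vx vxx vt where 2:
    "continuous_on ({-pi..pi} \<times> {0..T}) v"
    "\<forall>x\<in>{-pi..pi}. \<forall>t\<in>{0..T}. ((\<lambda>y. v (y, t)) has_real_derivative vx (x, t)) (at x within {-pi..pi})"
    "continuous_on ({-pi..pi} \<times> {0..T}) vx"
    "\<forall>x\<in>{-pi<..<pi}. \<forall>t\<in>{0<..<T}. ((\<lambda>y. vx (y, t)) has_real_derivative vxx (x, t)) (at x) \<and>
       ((\<lambda>s. v (x, s)) has_real_derivative vt (x, t)) (at t)"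
    "continuous_on ({-pi<..<pi} \<times> {0<..<T}) vxx" "continuous_on ({-pi<..<pi} \<times> {0<..<T}) vt"
    "continuous_on {-pi..pi} g"
    "\<forall>x\<in>{-pi<..<pi}. \<forall>t\<in>{0<..<T}. vt (x, t) - vxx (x, t) + \<epsilon> * vxx (-x, t) = g x"
    "\<forall>x\<in>{-pi..pi}. v (x, 0) = \<phi> x \<and> v (x, T) = \<psi> x"
    "\<forall>t\<in>{0..T}. v (-pi, t) = - v (pi, t) \<and> vx (-pi, t) = - vx (pi, t)"
    unfolding regular_solution_def by blast
  show ?thesis
    unfolding regular_solution_def
  proof (intro exI conjI ballI)
    fix x t assume x: "x \<in> {-pi<..<pi}" and t: "t \<in> {0<..<T}"
    have "ut (x, t) - uxx (x, t) + \<epsilon> * uxx (-x, t) = f x" "vt (x, t) - vxx (x, t) + \<epsilon> * vxx (-x, t) = g x"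
      using 1(8) 2(8) x t by blast+
    then show "(ut (x, t) - vt (x, t)) - (uxx (x, t) - vxx (x, t)) + \<epsilon> * (uxx (-x, t) - vxx (-x, t)) = f x - g x"
      by (simp add: algebra_simps)
  next
    fix x t assume x: "x \<in> {-pi..pi}" and t: "t \<in> {0..T}"
    show "((\<lambda>y. u (y, t) - v (y, t)) has_real_derivative ux (x, t) - vx (x, t)) (at x within {-pi..pi})"
      using 1(2) 2(2) x t by (intro DERIV_diff) auto
  next
    fix x t assume x: "x \<in> {-pi<..<pi}" and t: "t \<in> {0<..<T}"
    show "((\<lambda>y. ux (y, t) - vx (y, t)) has_real_derivative uxx (x, t) - vxx (x, t)) (at x)"
         "((\<lambda>s. u (x, s) - v (x, s)) has_real_derivative ut (x, t) - vt (x, t)) (at t)"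
      using 1(4) 2(4) x t by (auto intro!: DERIV_diff)
  qed (use 1 2 in \<open>auto intro!: continuous_on_diff\<close>)
qed

lemma regular_solution_homogeneous:
  assumes T: "T > 0" and \<epsilon>: "\<bar>\<epsilon>\<bar> < 1"
    and sol: "regular_solution T \<epsilon> (\<lambda>_. 0) (\<lambda>_. 0) u f"
    and x: "x \<in> {-pi..pi}"
  shows "t \<in> {0..T} \<Longrightarrow> u (x, t) = 0" and "f x = 0"
proof -
  have u: "continuous_on ({-pi..pi} \<times> {0..T}) u" and f: "continuous_on {-pi..pi} f"
    and z: "\<And>x. x \<in> {-pi..pi} \<Longrightarrow> u (x, 0) = 0" "\<And>x. x \<in> {-pi..pi} \<Longrightarrow> u (x, T) = 0"
    using sol unfolding regular_solution_def by blast+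
  have *: "integral {-pi..pi} (\<lambda>x. f x * hcos \<theta> k x) = 0 \<and>
      (\<forall>t\<in>{0..T}. integral {-pi..pi} (\<lambda>x. u (x, t) * hcos \<theta> k x) = 0)"
    if refl: "\<And>x. hcos \<theta> k (-x) = \<sigma> * hcos \<theta> k x" and pos: "1 - \<sigma> * \<epsilon> > 0" for \<theta> k \<sigma>
  proof -
    define a where "a = (1 - \<sigma> * \<epsilon>) * (real k + 1/2)\<^sup>2"
    have "real k + 1/2 > 0" by (simp add: add_nonneg_pos)
    then have a: "a > 0" unfolding a_def using pos by simp
    define c where "c t = integral {-pi..pi} (\<lambda>x. u (x, t) * hcos \<theta> k x)" for t
    define F where "F = integral {-pi..pi} (\<lambda>x. f x * hcos \<theta> k x)"
    have ode: "exp (a * t) * (c t - F / a) = c 0 - F / a" if "t \<in> {0..T}" for t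
      using regular_solution_coefficient[OF sol refl pos that] by (simp add: a_def c_def F_def)
    have "c 0 = integral {-pi..pi} (\<lambda>x. 0)" "c T = integral {-pi..pi} (\<lambda>x. 0)"
      unfolding c_def by (rule integral_cong, simp add: z)+
    then have c0: "c 0 = 0" "c T = 0" by simp_all
    \<comment> \<open>At time \<open>T\<close> the identity reads
      \<open>exp (a * T) * F / a = F / a\<close>, while \<open>exp (a * T) > 1\<close>.\<close>
    have F: "F = 0" using ode[of T] T c0 a by simp
    have "c t = 0" if "t \<in> {0..T}" for t
      using ode[OF that] F c0 by simp
    then show ?thesis using F by (simp add: c_def F_def)
  qed
  have "\<epsilon> < 1" "- \<epsilon> < 1" using \<epsilon> by auto
  then have c: "integral {-pi..pi} (\<lambda>x. f x * hcos 0 k x) = 0 \<and>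
      (\<forall>t\<in>{0..T}. integral {-pi..pi} (\<lambda>x. u (x, t) * hcos 0 k x) = 0)"
    and s: "integral {-pi..pi} (\<lambda>x. f x * hcos (pi/2) k x) = 0 \<and>
      (\<forall>t\<in>{0..T}. integral {-pi..pi} (\<lambda>x. u (x, t) * hcos (pi/2) k x) = 0)" for k
    \<comment> \<open>Cosines are even and sines odd, so \<sigma> is 1 and -1, with rate factors
      \<open>1 - \<epsilon>\<close> and \<open>1 + \<epsilon>\<close>.\<close>
    using *[of 0 k 1] *[of "pi/2" k "-1"] by (simp_all add: hcos_0 hcos_pi_half)
  show "f x = 0"
    by (rule half_integer_trig_complete[OF f _ _ x]) (use c s in blast)+
  show "u (x, t) = 0" if "t \<in> {0..T}"
    by (rule half_integer_trig_complete[OF continuous_on_strip_slice[OF u that] _ _ x]) (use c s that in blast)+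
qed

subsection \<open>Existence\<close>

lemma coef1_eq_hcos: "coef1 g k = (1 / pi) * (LBINT x:{-pi..pi}. g x * hcos 0 k x)"
  and coef2_eq_hcos: "coef2 g k = (1 / pi) * (LBINT x:{-pi..pi}. g x * hcos (pi/2) k x)"
  by (simp_all add: coef1_def coef2_def hcos_0 hcos_pi_half)

text \<open>An odd number of integrations by parts exchanges the families: cosine moments of
  \<open>g\<close> come from sine coefficients of \<open>g3\<close>.\<close>

lemma integral_admissible_coef2:
  assumes "admissible_data g g1 g2 g3"
  shows "integral {-pi..pi} (\<lambda>x. g x * hcos 0 k x) = pi * (coef2 g3 k / (real k + 1/2) ^ 3)"
  unfolding integral_hcos_admissible[OF assms] coef2_eq_hcos add_0 by simp

text \<open>Here the phase reaches pi. The resulting minus sign is why the two series in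
  \<open>sol_u\<close> carry opposite signs.\<close>

lemma integral_admissible_coef1:
  assumes "admissible_data g g1 g2 g3"
  shows "integral {-pi..pi} (\<lambda>x. g x * hcos (pi/2) k x) = - pi * (coef1 g3 k / (real k + 1/2) ^ 3)"
proof -
  have "hcos (pi/2 + pi/2) k x = - hcos 0 k x" for x
    using hcos_add_pi[of 0 k x] by simp
  then have "(LBINT x:{-pi..pi}. g3 x * hcos (pi/2 + pi/2) k x) = - (LBINT x:{-pi..pi}. g3 x * hcos 0 k x)"
    by (simp only: set_lebesgue_integral_def mult_minus_right scaleR_minus_right
        Bochner_Integration.integral_minus)
  then show ?thesis
    unfolding integral_hcos_admissible[OF assms] coef1_eq_hcos by simp
qed

lemma hseries_summable_coef_diff:
  assumes "admissible_data g g1 g2 g3" "admissible_data h h1 h2 h3"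
  shows "hseries_summable (\<lambda>k. coef1 g3 k - coef1 h3 k)" "hseries_summable (\<lambda>k. coef2 g3 k - coef2 h3 k)"
proof -
  have diff: "summable (\<lambda>k. \<bar>a k - b k\<bar> / (real k + 1/2))"
    if "summable (\<lambda>k. \<bar>a k\<bar> / (real k + 1/2))" "summable (\<lambda>k. \<bar>b k\<bar> / (real k + 1/2))"
    for a b :: "nat \<Rightarrow> real"
  proof (rule summable_comparison_test'[OF summable_add[OF that]])
    fix k
    have "\<bar>a k - b k\<bar> / (real k + 1/2) \<le> (\<bar>a k\<bar> + \<bar>b k\<bar>) / (real k + 1/2)"
      by (intro divide_right_mono) auto
    then show "norm (\<bar>a k - b k\<bar> / (real k + 1/2)) \<le> \<bar>a k\<bar> / (real k + 1/2) + \<bar>b k\<bar> / (real k + 1/2)"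
      by (simp add: add_divide_distrib)
  qed
  have coef: "summable (\<lambda>k. \<bar>coef1 g3 k\<bar> / (real k + 1/2))" "summable (\<lambda>k. \<bar>coef2 g3 k\<bar> / (real k + 1/2))"
    if adm: "admissible_data g g1 g2 g3" for g g1 g2 g3
  proof -
    have "set_borel_measurable lborel {-pi..pi} g3" "set_integrable lborel {-pi..pi} (\<lambda>x. (g3 x)\<^sup>2)"
      using adm unfolding admissible_data_def by blast+
    note s = summable_hcos_coefficient_over_frequency[OF summable_hcos_coefficient_squares[OF this]]
    show "summable (\<lambda>k. \<bar>coef1 g3 k\<bar> / (real k + 1/2))" "summable (\<lambda>k. \<bar>coef2 g3 k\<bar> / (real k + 1/2))"
      unfolding coef1_eq_hcos coef2_eq_hcos by (rule s)+
  qed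
  show "hseries_summable (\<lambda>k. coef1 g3 k - coef1 h3 k)" "hseries_summable (\<lambda>k. coef2 g3 k - coef2 h3 k)"
    unfolding hseries_summable_def
    by (rule diff[OF coef(1)[OF assms(1)] coef(1)[OF assms(2)]] diff[OF coef(2)[OF assms(1)] coef(2)[OF assms(2)]])+
qed

lemma sol_u_eq_hseries:
  "sol_u T \<epsilon> \<phi> \<phi>3 \<psi>3 (x, t) = \<phi> x
    - hseries (\<lambda>k. coef2 \<phi>3 k - coef2 \<psi>3 k) 3 0 (amp (1 - \<epsilon>) T) (x, t)
    + hseries (\<lambda>k. coef1 \<phi>3 k - coef1 \<psi>3 k) 3 (pi/2) (amp (1 + \<epsilon>) T) (x, t)"
  by (simp only: sol_u_def hseries_def case_prod_conv amp_def hcos_0 hcos_pi_half times_divide_times_eq)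

text \<open>The time is 0 because \<open>amp'\<close> takes there the constant value on the right of
  \<open>amp_sum\<close>.\<close>

lemma sol_f_eq_hseries:
  "sol_f T \<epsilon> \<phi>2 \<phi>3 \<psi>3 x = - \<phi>2 x + \<epsilon> * \<phi>2 (- x)
    - hseries (\<lambda>k. coef2 \<phi>3 k - coef2 \<psi>3 k) 1 0 (amp' (1 - \<epsilon>) T) (x, 0)
    + hseries (\<lambda>k. coef1 \<phi>3 k - coef1 \<psi>3 k) 1 (pi/2) (amp' (1 + \<epsilon>) T) (x, 0)"
  by (simp only: sol_f_def hseries_def case_prod_conv amp'_def hcos_0 hcos_pi_half times_divide_times_eq
      mult_zero_right exp_zero mult_1_right power_one_right mult.commute[of _ "real _ + 1/2"])

lemma sol_regular:
  fixes T \<epsilon> :: real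
  assumes T: "T > 0" and \<epsilon>: "\<bar>\<epsilon>\<bar> < 1"
    and adm\<phi>: "admissible_data \<phi> \<phi>1 \<phi>2 \<phi>3" and adm\<psi>: "admissible_data \<psi> \<psi>1 \<psi>2 \<psi>3"
  shows "regular_solution T \<epsilon> \<phi> \<psi> (sol_u T \<epsilon> \<phi> \<phi>3 \<psi>3) (sol_f T \<epsilon> \<phi>2 \<phi>3 \<psi>3)"
proof -
  define A where "A k = coef2 \<phi>3 k - coef2 \<psi>3 k" for k
  define B where "B k = coef1 \<phi>3 k - coef1 \<psi>3 k" for k
  interpret A: hseries_summable A unfolding A_def by (rule hseries_summable_coef_diff[OF adm\<phi> adm\<psi>])
  interpret B: hseries_summable B unfolding B_def by (rule hseries_summable_coef_diff[OF adm\<phi> adm\<psi>])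
  define a where "a = amp (1 - \<epsilon>) T"
  define b where "b = amp (1 + \<epsilon>) T"
  define a' where "a' = amp' (1 - \<epsilon>) T"
  define b' where "b' = amp' (1 + \<epsilon>) T"
  have \<mu>: "1 - \<epsilon> > 0" "1 + \<epsilon> > 0" using \<epsilon> by auto
  obtain Ka where Ka: "\<And>k t. t \<ge> 0 \<Longrightarrow> \<bar>a k t\<bar> \<le> Ka" unfolding a_def using amp_bounded[OF \<mu>(1) T] by blast
  obtain Kb where Kb: "\<And>k t. t \<ge> 0 \<Longrightarrow> \<bar>b k t\<bar> \<le> Kb" unfolding b_def using amp_bounded[OF \<mu>(2) T] by blast
  obtain Ka' where Ka': "\<And>k t. t \<ge> 0 \<Longrightarrow> \<bar>a' k t\<bar> \<le> Ka'" unfolding a'_def using amp'_bounded[OF \<mu>(1) T] by blast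
  obtain Kb' where Kb': "\<And>k t. t \<ge> 0 \<Longrightarrow> \<bar>b' k t\<bar> \<le> Kb'" unfolding b'_def using amp'_bounded[OF \<mu>(2) T] by blast
  have ca: "continuous_on S (a k)" and cb: "continuous_on S (b k)"
    and ca': "continuous_on S (a' k)" and cb': "continuous_on S (b' k)" for S k
    unfolding a_def b_def a'_def b'_def using \<mu> T by (auto intro: amp_continuous)
  have cont: "continuous_on ({-pi..pi} \<times> {0..T}) (hseries A (Suc p) \<theta> a)"
    "continuous_on ({-pi..pi} \<times> {0..T}) (hseries B (Suc p) \<theta> b)"
    "continuous_on ({-pi..pi} \<times> {0..T}) (hseries A (Suc p) \<theta> a')"
    "continuous_on ({-pi..pi} \<times> {0..T}) (hseries B (Suc p) \<theta> b')" for p \<theta>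
    by (rule continuous_on_subset[OF A.continuous_on_hseries[of "{0..}" a Ka]];
          use Ka ca in force)
      (rule continuous_on_subset[OF B.continuous_on_hseries[of "{0..}" b Kb]]
          continuous_on_subset[OF A.continuous_on_hseries[of "{0..}" a' Ka']]
          continuous_on_subset[OF B.continuous_on_hseries[of "{0..}" b' Kb']];
        use Kb cb Ka' ca' Kb' cb' in force)+
  have d\<phi>: "\<And>x. x \<in> {-pi..pi} \<Longrightarrow> (\<phi> has_real_derivative \<phi>1 x) (at x within {-pi..pi})"
    and d\<phi>1: "\<And>x. x \<in> {-pi..pi} \<Longrightarrow> (\<phi>1 has_real_derivative \<phi>2 x) (at x within {-pi..pi})"
    and \<phi>2: "continuous_on {-pi..pi} \<phi>2"
    and anti: "\<phi> (-pi) = - \<phi> pi" "\<phi>1 (-pi) = - \<phi>1 pi"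
    using adm\<phi> unfolding admissible_data_def by blast+
  have \<psi>: "continuous_on {-pi..pi} \<psi>"
    using adm\<psi> DERIV_continuous_on unfolding admissible_data_def by blast
  have \<phi>: "continuous_on {-pi..pi} \<phi>" and \<phi>1: "continuous_on {-pi..pi} \<phi>1"
    using d\<phi> d\<phi>1 DERIV_continuous_on by blast+
  define u where "u = (\<lambda>(x, t). \<phi> x - hseries A 3 0 a (x, t) + hseries B 3 (pi/2) b (x, t))"
  \<comment> \<open>The unreduced phases, and the summand 0 in \<open>ut\<close>, have the shape
    that the termwise derivative rules produce.\<close>
  define ux where "ux = (\<lambda>(x, t). \<phi>1 x - hseries A 2 (0 - pi/2) a (x, t) + hseries B 2 (pi/2 - pi/2) b (x, t))"
  define uxx where "uxx = (\<lambda>(x, t). \<phi>2 x - hseries A 1 (0 - pi/2 - pi/2) a (x, t) + hseries B 1 (pi/2 - pi/2 - pi/2) b (x, t))"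
  define ut where "ut = (\<lambda>(x, t). 0 - hseries A 1 0 a' (x, t) + hseries B 1 (pi/2) b' (x, t))"
  define f where "f = (\<lambda>x. - \<phi>2 x + \<epsilon> * \<phi>2 (- x) - hseries A 1 0 a' (x, 0) + hseries B 1 (pi/2) b' (x, 0))"
  have ueq: "sol_u T \<epsilon> \<phi> \<phi>3 \<psi>3 = u"
    by (rule ext) (simp add: sol_u_eq_hseries u_def a_def b_def A_def[abs_def] B_def[abs_def] split: prod.split)
  have feq: "sol_f T \<epsilon> \<phi>2 \<phi>3 \<psi>3 = f"
    by (rule ext) (simp only: sol_f_eq_hseries f_def a'_def b'_def A_def[abs_def] B_def[abs_def])
  \<comment> \<open>Turns the exponents 3, 2, 1 into successors, the form in which the facts on
    \<open>hseries\<close> are stated.\<close>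
  note n = numeral_3_eq_3 numeral_2_eq_2 One_nat_def
  have sub: "{-pi<..<pi} \<times> {0<..<T} \<subseteq> {-pi..pi} \<times> {0..T}" by auto
  have c\<phi>: "continuous_on ({-pi..pi} \<times> {0..T}) (\<lambda>z. g (fst z))" if "continuous_on {-pi..pi} g" for g :: "real \<Rightarrow> real"
    by (rule continuous_on_compose2[OF that]) (auto intro!: continuous_intros)
  have cu: "continuous_on ({-pi..pi} \<times> {0..T}) u"
    unfolding u_def case_prod_beta' prod.collapse n by (intro continuous_intros c\<phi> \<phi> cont)
  have cux: "continuous_on ({-pi..pi} \<times> {0..T}) ux"
    unfolding ux_def case_prod_beta' prod.collapse n by (intro continuous_intros c\<phi> \<phi>1 cont)
  have cuxx: "continuous_on ({-pi..pi} \<times> {0..T}) uxx"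
    unfolding uxx_def case_prod_beta' prod.collapse n by (intro continuous_intros c\<phi> \<phi>2 cont)
  have cut: "continuous_on ({-pi..pi} \<times> {0..T}) ut"
    unfolding ut_def case_prod_beta' prod.collapse n by (intro continuous_intros cont)
  have cf: "continuous_on {-pi..pi} f"
  proof -
    have "continuous_on {-pi..pi} (\<lambda>x. \<phi>2 (- x))"
      by (rule continuous_on_compose2[OF \<phi>2]) (auto intro!: continuous_intros)
    then show ?thesis
      unfolding f_def n using T
      by (intro continuous_intros \<phi>2 continuous_on_strip_slice[OF cont(3)] continuous_on_strip_slice[OF cont(4)]) auto
  qed
  have dux: "((\<lambda>y. u (y, t)) has_real_derivative ux (x, t)) (at x within {-pi..pi})"
    if "x \<in> {-pi..pi}" "t \<in> {0..T}" for x t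
    unfolding u_def ux_def case_prod_conv n
    by (intro DERIV_add DERIV_diff d\<phi> has_field_derivative_at_within[OF A.hseries_has_x_derivative[where B = Ka]]
        has_field_derivative_at_within[OF B.hseries_has_x_derivative[where B = Kb]])
      (use that Ka Kb in auto)
  have duxx: "((\<lambda>y. ux (y, t)) has_real_derivative uxx (x, t)) (at x)"
    if "x \<in> {-pi<..<pi}" "t \<in> {0<..<T}" for x t
  proof -
    have "(\<phi>1 has_real_derivative \<phi>2 x) (at x)"
      using d\<phi>1[of x] that(1) by (simp add: at_within_Icc_at)
    then show ?thesis
      unfolding ux_def uxx_def case_prod_conv n
      by (intro DERIV_add DERIV_diff A.hseries_has_x_derivative[where B = Ka] B.hseries_has_x_derivative[where B = Kb])
        (use that Ka Kb in auto)
  qed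
  have dut: "((\<lambda>s. u (x, s)) has_real_derivative ut (x, t)) (at t)"
    if "t \<in> {0<..<T}" for x t
    unfolding u_def ut_def case_prod_conv n
    by (intro DERIV_add DERIV_diff DERIV_const A.hseries_has_t_derivative[where B = Ka and B' = Ka']
        B.hseries_has_t_derivative[where B = Kb and B' = Kb'])
      (use that Ka Kb Ka' Kb' amp_has_derivative[OF \<mu>(1) T] amp_has_derivative[OF \<mu>(2) T]
        in \<open>auto simp: a_def b_def a'_def b'_def\<close>)
  have eq: "ut (x, t) - uxx (x, t) + \<epsilon> * uxx (-x, t) = f x" if t: "t \<in> {0<..<T}" for x t
  proof -
    have t0: "t \<ge> 0" using t by simp
    have A: "hseries A (Suc 0) 0 a' (x, t) + (1 - \<epsilon>) * hseries A (Suc 0) 0 a (x, t) = hseries A (Suc 0) 0 a' (x, 0)"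
      by (rule A.hseries_linear_combination[of a' t _ a, OF Ka'[OF t0] Ka[OF t0]])
        (simp add: a_def a'_def amp_sum[OF \<mu>(1) T])
    have B: "hseries B (Suc 0) (pi/2) b' (x, t) + (1 + \<epsilon>) * hseries B (Suc 0) (pi/2) b (x, t) = hseries B (Suc 0) (pi/2) b' (x, 0)"
      by (rule B.hseries_linear_combination[of b' t _ b, OF Kb'[OF t0] Kb[OF t0]])
        (simp add: b_def b'_def amp_sum[OF \<mu>(2) T])
    \<comment> \<open>Reflection fixes the cosine series and negates the sine series, so the two
      second-derivative terms combine with weights \<open>1 - \<epsilon>\<close> and
      \<open>1 + \<epsilon>\<close>.\<close>
    have Ax: "hseries A (Suc 0) 0 a (- x, t) = 1 * hseries A (Suc 0) 0 a (x, t)"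
      by (rule A.hseries_neg_x[of a, OF Ka[OF t0]]) (simp add: hcos_0)
    have Bx: "hseries B (Suc 0) (pi/2) b (- x, t) = - 1 * hseries B (Suc 0) (pi/2) b (x, t)"
      by (rule B.hseries_neg_x[of b, OF Kb[OF t0]]) (simp add: hcos_pi_half)
    show ?thesis
      unfolding ut_def uxx_def f_def case_prod_conv One_nat_def A[symmetric] B[symmetric]
        A.hseries_phase_minus_pi[of a, OF Ka[OF t0]] B.hseries_phase_minus_pi[of b, OF Kb[OF t0]] Ax Bx
      by (simp add: algebra_simps)
  qed
  have u0: "u (x, 0) = \<phi> x" for x
    using amp_0[OF \<mu>(1) T] amp_0[OF \<mu>(2) T] by (simp add: u_def hseries_def a_def b_def)
  have uT: "u (x, T) = \<psi> x" if x: "x \<in> {-pi..pi}" for x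
  proof -
    have T0: "T \<ge> 0" "T \<in> {0..T}" using T by auto
    have ab1: "a k T = 1" "b k T = 1" for k using amp_T[OF \<mu>(1) T] amp_T[OF \<mu>(2) T] by (simp_all add: a_def b_def)
    have i: "integral {-pi..pi} (\<lambda>x. (u (x, T) - \<psi> x) * hcos \<theta> k x) =
        integral {-pi..pi} (\<lambda>x. \<phi> x * hcos \<theta> k x) - integral {-pi..pi} (\<lambda>x. \<psi> x * hcos \<theta> k x)
        - pi * cos (0 - \<theta>) * (A k / (real k + 1/2) ^ 3) + pi * cos (pi/2 - \<theta>) * (B k / (real k + 1/2) ^ 3)" for \<theta> k
    proof -
      have "integral {-pi..pi} (\<lambda>x. (u (x, T) - \<psi> x) * hcos \<theta> k x) =
          integral {-pi..pi} (\<lambda>x. \<phi> x * hcos \<theta> k x - \<psi> x * hcos \<theta> k x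
            - hseries A 3 0 a (x, T) * hcos \<theta> k x + hseries B 3 (pi/2) b (x, T) * hcos \<theta> k x)"
        by (simp only: u_def case_prod_conv) (simp add: algebra_simps)
      also have "\<dots> = integral {-pi..pi} (\<lambda>x. \<phi> x * hcos \<theta> k x) - integral {-pi..pi} (\<lambda>x. \<psi> x * hcos \<theta> k x)
          - integral {-pi..pi} (\<lambda>x. hseries A 3 0 a (x, T) * hcos \<theta> k x)
          + integral {-pi..pi} (\<lambda>x. hseries B 3 (pi/2) b (x, T) * hcos \<theta> k x)"
        unfolding n
        by (subst integral_add integral_diff,
            (intro integrable_continuous_real continuous_intros \<phi> \<psi>
              continuous_on_strip_slice[OF cont(1) T0(2)] continuous_on_strip_slice[OF cont(2) T0(2)])+)+ simp
      finally show ?thesis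
        unfolding n A.integral_hseries_hcos[of a, OF Ka[OF T0(1)]] B.integral_hseries_hcos[of b, OF Kb[OF T0(1)]] ab1
        by simp
    qed
    \<comment> \<open>The difference is continuous and all its half-integer coefficients vanish, so
      completeness applies.\<close>
    have "u (x, T) - \<psi> x = 0"
    proof (rule half_integer_trig_complete[OF _ _ _ x])
      show "continuous_on {-pi..pi} (\<lambda>x. u (x, T) - \<psi> x)"
        by (intro continuous_intros \<psi> continuous_on_strip_slice[OF cu T0(2)])
      show "integral {-pi..pi} (\<lambda>x. (u (x, T) - \<psi> x) * hcos 0 k x) = 0" for k
        unfolding i integral_admissible_coef2[OF adm\<phi>] integral_admissible_coef2[OF adm\<psi>]
        by (simp add: A_def diff_divide_distrib right_diff_distrib)
      show "integral {-pi..pi} (\<lambda>x. (u (x, T) - \<psi> x) * hcos (pi/2) k x) = 0" for k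
        unfolding i integral_admissible_coef1[OF adm\<phi>] integral_admissible_coef1[OF adm\<psi>]
        by (simp add: B_def diff_divide_distrib right_diff_distrib)
    qed
    then show ?thesis by simp
  qed
  have au: "u (-pi, t) = - u (pi, t)" "ux (-pi, t) = - ux (pi, t)" if "t \<in> {0..T}" for t
  proof -
    have t0: "t \<ge> 0" using that by simp
    show "u (-pi, t) = - u (pi, t)" "ux (-pi, t) = - ux (pi, t)"
      unfolding u_def ux_def case_prod_conv n anti
        A.hseries_antiperiodic[of a, OF Ka[OF t0]] B.hseries_antiperiodic[of b, OF Kb[OF t0]]
      by simp_all
  qed
  show ?thesis
    unfolding regular_solution_def ueq feq
    by (rule exI[of _ ux], rule exI[of _ uxx], rule exI[of _ ut])
      (intro conjI ballI cu cux cf dux duxx dut eq u0 uT au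
        continuous_on_subset[OF cuxx sub] continuous_on_subset[OF cut sub]; assumption)
qed

theorem theorem4:
  fixes T \<epsilon> :: real
    and \<phi> \<phi>1 \<phi>2 \<phi>3 \<psi> \<psi>1 \<psi>2 \<psi>3 :: "real \<Rightarrow> real"
  assumes "T > 0" and "\<epsilon> \<noteq> 0" and "\<bar>\<epsilon>\<bar> < 1"
    and "admissible_data \<phi> \<phi>1 \<phi>2 \<phi>3"
    and "admissible_data \<psi> \<psi>1 \<psi>2 \<psi>3"
  shows "regular_solution T \<epsilon> \<phi> \<psi> (sol_u T \<epsilon> \<phi> \<phi>3 \<psi>3) (sol_f T \<epsilon> \<phi>2 \<phi>3 \<psi>3) \<and>
         (\<forall>u f. regular_solution T \<epsilon> \<phi> \<psi> u f \<longrightarrow>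
            (\<forall>x\<in>{-pi..pi}. \<forall>t\<in>{0..T}. u (x, t) = sol_u T \<epsilon> \<phi> \<phi>3 \<psi>3 (x, t)) \<and>
            (\<forall>x\<in>{-pi..pi}. f x = sol_f T \<epsilon> \<phi>2 \<phi>3 \<psi>3 x))"
proof (intro conjI allI impI ballI)
  show sol: "regular_solution T \<epsilon> \<phi> \<psi> (sol_u T \<epsilon> \<phi> \<phi>3 \<psi>3) (sol_f T \<epsilon> \<phi>2 \<phi>3 \<psi>3)"
    by (rule sol_regular) (rule assms)+
  fix u f assume "regular_solution T \<epsilon> \<phi> \<psi> u f"
  note zero = regular_solution_homogeneous[OF assms(1,3) regular_solution_diff[OF this sol]]
  show "u (x, t) = sol_u T \<epsilon> \<phi> \<phi>3 \<psi>3 (x, t)" if "x \<in> {-pi..pi}" "t \<in> {0..T}" for x t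
    using zero(1)[OF that] by simp
  show "f x = sol_f T \<epsilon> \<phi>2 \<phi>3 \<psi>3 x" if "x \<in> {-pi..pi}" for x
    using zero(2)[OF that] by simp
qed

end
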